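(* Let $a=\rho\cos\theta$, $b=\rho\sin\theta$ with $\rho\ge 1$ and $0<a<1/2$. Let $\Lambda=\{u_1(1,0)+u_2(a,b): u_1,u_2\in\mathbb{Z}\}$ and let $\mathcal{V}_{\mathbf 0}$ be its Voronoi cell at the origin. Let $\mathbf{X}=(X_1,X_2)$ be uniformly distributed on the Babai cell $\mathcal{B}_{\mathbf 0}=[-1/2,1/2)\times[-b/2,b/2)$, with $X_1$ known only to node-1 and $X_2$ known only to node-2. Run the bit-exchange protocol described in the context. Then the protocol halts with probability one, and when it halts both nodes know the nearest lattice point to $\mathbf{X}$, i.e. the error probability is $0$. Moreover, with $Q=(Q_{-1},Q_0,Q_1)$, $Q_i=\Pr(W_2=i)$, and $P=(P_{-1},P_0,P_1)$, $P_i=\Pr(W_1=i\mid W_2=1)$, the expected total number of communicated bits and the expected number of rounds are finite and equal to $$\bar R=E[R(\mathbf{X})]=H(Q)+(1-Q_0)H(P)+4(1-P_0)(1-Q_0),\qquad \bar N=E[N(\mathbf{X})]=1+2(1-P_0)(1-Q_0),$$ where $H(\cdot)$ denotes the base-2 entropy of a probability vector.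
   Context: Notation: $a=\rho\cos\theta$, $b=\rho\sin\theta$, $\rho\ge1$, $0<a<1/2$. The lattice $\Lambda$ has generator matrix $\begin{pmatrix}1&a\\0&b\end{pmatrix}$ (columns are basis vectors). $\mathcal{V}_{\mathbf 0}$ is the set of points of $\mathbb{R}^2$ whose nearest lattice point is $\mathbf 0$; its boundary is formed by the perpendicular bisectors of $\pm(1,0)$, $\pm(a,b)$, $\pm(a-1,b)$. The Babai cell at the origin is $\mathcal{B}_{\mathbf 0}=[-1/2,1/2)\times[-b/2,b/2)$. Thresholds and intervals: let $\tau_1=b/2-\frac{a(1-a)}{2b}$ and $\tau_{-1}=-\tau_1$; define $\mathcal J_{-1}=[-b/2,\tau_{-1}]$, $\mathcal J_0=(\tau_{-1},\tau_1]$, $\mathcal J_1=(\tau_1,b/2)$. Define $\mathcal I_{-1}=[-1/2,(a-1)/2]$, $\mathcal I_0=((a-1)/2,a/2]$, $\mathcal I_1=(a/2,1/2)$. Protocol. Round 1: node-2 sends $W_2=i$ where $X_2\in\mathcal J_i$. If $W_2=0$ nothing further is sent in round 1. If $W_2=1$, node-1 sends $W_1=i$ where $X_1\in\mathcal I_i$; if $W_2=-1$, node-1 sends $W_1=i$ where $-X_1\in\mathcal I_i$. Round-1 messages are encoded with ideal entropy-code lengths: $W_2=i$ costs $\log_2(1/Q_i)$ bits and, when sent, $W_1=i$ costs $\log_2(1/\Pr(W_1=i\mid W_2))$ bits (by symmetry $\Pr(W_1=i\mid W_2=-1)=P_i$). After round 1 both nodes know a rectangle (product of an $X_1$-interval and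 an $X_2$-interval) containing $\mathbf{X}$. A rectangle is called error-free if its interior does not intersect the boundary of $\mathcal{V}_{\mathbf 0}$ (hence all its interior points have the same nearest lattice point). If the current rectangle is error-free, communication halts. Otherwise (this happens exactly when $W_2\neq0$ and $W_1\neq0$, and then a boundary segment of $\mathcal{V}_{\mathbf 0}$ is a diagonal of the current rectangle), in each subsequent round node-1 sends one bit indicating which half (left/right) of its current interval contains $X_1$, and node-2 sends one bit indicating which half of its current interval contains $X_2$; the current rectangle is replaced by the resulting quarter, and communication halts at the end of the first round in which the current rectangle is error-free. $N(\mathbf{X})$ is the number of rounds (round 1 included) and $R(\mathbf{X})$ is the total number of bits sent (round-1 code lengths plus $2$ bits per later round). For reference, these distributions are explicitly $Q_1=Q_{-1}=\frac{a(1-a)}{2b^2}$, $Q_0=1-2Q_1$, and $P=(a/2,\,1/2,\,(1-a)/2)$. *)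

theory Defs
  imports "HOL-Probability.Probability"
begin

text \<open>Points of the plane are pairs (x1, x2) :: real \<times> real (Euclidean norm).
  Parameters: a = rho cos theta, b = rho sin theta.\<close>

type_synonym pt = "real \<times> real"
type_synonym ivl = "real \<times> real"          \<comment> \<open>closed interval (lo, hi)\<close>
type_synonym rect = "ivl \<times> ivl"             \<comment> \<open>X1-interval, X2-interval\<close>

definition lattice :: "real \<Rightarrow> real \<Rightarrow> pt set" where
  "lattice a b = {(of_int u1 + of_int u2 * a, of_int u2 * b) | u1 u2. True}"

definition voronoi0 :: "real \<Rightarrow> real \<Rightarrow> pt set" where
  "voronoi0 a b = {p. \<forall>l\<in>lattice a b. dist p 0 \<le> dist p l}"

definition babai_cell :: "real \<Rightarrow> pt set" where
  "babai_cell b = {-1/2..<1/2} \<times> {-b/2..<b/2}"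

definition tau1 :: "real \<Rightarrow> real \<Rightarrow> real" where
  "tau1 a b = b/2 - a*(1-a)/(2*b)"

text \<open>Round-1 message of node 2: index i with X2 in J_i.\<close>
definition W2 :: "real \<Rightarrow> real \<Rightarrow> pt \<Rightarrow> int" where
  "W2 a b x = (if snd x \<le> - tau1 a b then -1 else if snd x \<le> tau1 a b then 0 else 1)"

definition Iidx :: "real \<Rightarrow> real \<Rightarrow> int" where
  "Iidx a t = (if t \<le> (a-1)/2 then -1 else if t \<le> a/2 then 0 else 1)"

text \<open>Round-1 message of node 1 (value 0 is a dummy when W2 = 0, nothing is sent).\<close>
definition W1 :: "real \<Rightarrow> real \<Rightarrow> pt \<Rightarrow> int" where
  "W1 a b x = (if W2 a b x = 1 then Iidx a (fst x)
               else if W2 a b x = -1 then Iidx a (- fst x) else 0)"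

text \<open>Closures of the intervals J_i and I_i.\<close>
definition Jint :: "real \<Rightarrow> real \<Rightarrow> int \<Rightarrow> ivl" where
  "Jint a b i = (if i = -1 then (-b/2, - tau1 a b)
                 else if i = 0 then (- tau1 a b, tau1 a b) else (tau1 a b, b/2))"

definition Iint :: "real \<Rightarrow> int \<Rightarrow> ivl" where
  "Iint a i = (if i = -1 then (-1/2, (a-1)/2)
               else if i = 0 then ((a-1)/2, a/2) else (a/2, 1/2))"

text \<open>Rectangle known to both nodes after round 1.\<close>
definition rect1 :: "real \<Rightarrow> real \<Rightarrow> pt \<Rightarrow> rect" where
  "rect1 a b x =
     (if W2 a b x = 0 then ((-1/2, 1/2), Jint a b 0)
      else if W2 a b x = 1 then (Iint a (W1 a b x), Jint a b 1)
      else ((- snd (Iint a (W1 a b x)), - fst (Iint a (W1 a b x))), Jint a b (-1)))"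

definition rect_set :: "rect \<Rightarrow> pt set" where
  "rect_set r = {fst (fst r) .. snd (fst r)} \<times> {fst (snd r) .. snd (snd r)}"

text \<open>One later round: each node reports which half of its interval contains its coordinate.\<close>
definition halve_iv :: "real \<Rightarrow> ivl \<Rightarrow> ivl" where
  "halve_iv t I = (let m = (fst I + snd I) / 2 in if t \<le> m then (fst I, m) else (m, snd I))"

definition halve :: "pt \<Rightarrow> rect \<Rightarrow> rect" where
  "halve x r = (halve_iv (fst x) (fst r), halve_iv (snd x) (snd r))"

text \<open>rects a b x k = current rectangle after round k+1.\<close>
definition rects :: "real \<Rightarrow> real \<Rightarrow> pt \<Rightarrow> nat \<Rightarrow> rect" where
  "rects a b x k = (halve x ^^ k) (rect1 a b x)"

definition error_free :: "real \<Rightarrow> real \<Rightarrow> rect \<Rightarrow> bool" where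
  "error_free a b r \<longleftrightarrow> interior (rect_set r) \<inter> frontier (voronoi0 a b) = {}"

definition halts :: "real \<Rightarrow> real \<Rightarrow> pt \<Rightarrow> bool" where
  "halts a b x \<longleftrightarrow> (\<exists>k. error_free a b (rects a b x k))"

text \<open>N(X): number of rounds, round 1 included.\<close>
definition num_rounds :: "real \<Rightarrow> real \<Rightarrow> pt \<Rightarrow> nat" where
  "num_rounds a b x = Suc (LEAST k. error_free a b (rects a b x k))"

definition final_rect :: "real \<Rightarrow> real \<Rightarrow> pt \<Rightarrow> rect" where
  "final_rect a b x = rects a b x (num_rounds a b x - 1)"

definition Mu :: "real \<Rightarrow> pt measure" where
  "Mu b = uniform_measure lborel (babai_cell b)"

definition Qprob :: "real \<Rightarrow> real \<Rightarrow> int \<Rightarrow> real" where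
  "Qprob a b i = measure (Mu b) {x. W2 a b x = i}"

definition Pcond :: "real \<Rightarrow> real \<Rightarrow> int \<Rightarrow> int \<Rightarrow> real" where
  "Pcond a b j i = measure (Mu b) {x. W2 a b x = j \<and> W1 a b x = i} / Qprob a b j"

definition round1_cost :: "real \<Rightarrow> real \<Rightarrow> pt \<Rightarrow> real" where
  "round1_cost a b x = log 2 (1 / Qprob a b (W2 a b x))
     + (if W2 a b x \<noteq> 0 then log 2 (1 / Pcond a b (W2 a b x) (W1 a b x)) else 0)"

definition num_bits :: "real \<Rightarrow> real \<Rightarrow> pt \<Rightarrow> real" where
  "num_bits a b x = round1_cost a b x + 2 * real (num_rounds a b x - 1)"

definition entropy3 :: "(int \<Rightarrow> real) \<Rightarrow> real" where
  "entropy3 p = (\<Sum>i\<in>{-1, 0, 1}. if p i = 0 then 0 else - p i * log 2 (p i))"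

end

theory Submission
  imports Defs
begin

text \<open>Inside the Babai cell only the four rectangles with \<open>W\<^sub>2 \<noteq> 0\<close> and \<open>W\<^sub>1 \<noteq> 0\<close> meet the boundary
  of the Voronoi cell, and there the boundary is exactly one diagonal, a piece of the bisector of
  a relevant vector. Halving a rectangle with such a diagonal gives two quarters that are again cut
  along a diagonal, while the two others lie strictly on one side. Hence after \<open>k\<close> later rounds the
  protocol is still running with probability \<open>2\<^sup>-\<^sup>k\<close> times that of \<open>W\<^sub>2 \<noteq> 0\<close>, \<open>W\<^sub>1 \<noteq> 0\<close>, and
  summing this geometric tail gives the expected number of rounds.\<close>

text \<open>The messages are tuned to the hexagon. Its vertices on the lines x1 = \<plusminus>1/2
  have heights \<plusminus>\<open>tau1 a b\<close>, and the bisectors of the oblique relevant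
  vectors meet x2 = \<plusminus>b/2 at the halves of these vectors, whose first coordinates are the
  inner endpoints of the intervals I_i (reflected below). So each oblique bisector joins two
  opposite corners of one outer cell.

  Two gaps separate this picture from the claim. The Voronoi cell is cut out by infinitely many
  inequalities, and six of them must be shown to suffice. Moreover \<open>error_free\<close> only
  compares the interior of a rectangle with the frontier of the cell around 0, whereas a decision is
  wanted for the point itself, which may be nearest to a neighbour \<open>n\<close> or sit on an
  edge of its final rectangle. Hence the strict cells, the translates by \<open>n\<close>, and the
  removal of finitely many lines, a null set.\<close>

section \<open>Voronoi inequalities, weak and strict, and their invariance under x -> -x\<close>

text \<open>The inequality is \<open>dist p 0 < dist p l\<close> squared out, so 0 is the unique
  nearest lattice point; on the boundary of \<open>voronoi0\<close> it is only one of
  several.\<close>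

definition strict_voronoi0 :: "real \<Rightarrow> real \<Rightarrow> pt set" where
  "strict_voronoi0 a b = {p. \<forall>l\<in>lattice a b. l \<noteq> 0 \<longrightarrow> p \<bullet> l < (l \<bullet> l) / 2}"

text \<open>The superbase (1, 0), (a - 1, b), (-a, -b) and its negatives: the three vectors sum to
  zero, and in the locale \<open>obtuse\<close> any two of them have negative inner product.\<close>

definition relevant :: "real \<Rightarrow> real \<Rightarrow> pt set" where
  "relevant a b = {(1, 0), (a, b), (a - 1, b), (-1, 0), (-a, -b), (1 - a, -b)}"

lemma dist_le_dist_iff:
  fixes p l :: "'a::real_inner"
  shows "dist p 0 \<le> dist p l \<longleftrightarrow> p \<bullet> l \<le> (l \<bullet> l) / 2"
    and "dist p 0 < dist p l \<longleftrightarrow> p \<bullet> l < (l \<bullet> l) / 2"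
  by (simp_all add: dist_norm norm_le norm_lt inner_diff inner_commute field_simps)

lemma voronoi0_iff: "p \<in> voronoi0 a b \<longleftrightarrow> (\<forall>l\<in>lattice a b. p \<bullet> l \<le> (l \<bullet> l) / 2)"
  unfolding voronoi0_def dist_le_dist_iff by simp

lemma closed_voronoi0: "closed (voronoi0 a b)"
proof -
  have "voronoi0 a b = (\<Inter>l\<in>lattice a b. {p. p \<bullet> l \<le> (l \<bullet> l) / 2})"
    unfolding set_eq_iff voronoi0_iff by blast
  moreover have "closed {p. p \<bullet> l \<le> (l \<bullet> l) / 2}" for l :: pt
    by (intro closed_Collect_le continuous_intros)
  ultimately show ?thesis by auto
qed

lemma zero_in_lattice: "0 \<in> lattice a b"
  unfolding lattice_def mem_Collect_eq by (intro exI[of _ 0]) (simp add: zero_prod_def)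

lemma lattice_diff:
  assumes "l \<in> lattice a b" "m \<in> lattice a b"
  shows "m - l \<in> lattice a b"
proof -
  obtain u v u' v' where
    "l = (of_int u + of_int v * a, of_int v * b)" "m = (of_int u' + of_int v' * a, of_int v' * b)"
    using assms by (auto simp: lattice_def)
  then have "m - l = (of_int (u' - u) + of_int (v' - v) * a, of_int (v' - v) * b)"
    by (simp add: algebra_simps)
  then show ?thesis unfolding lattice_def mem_Collect_eq by (intro exI conjI TrueI)
qed

lemma lattice_minus: "l \<in> lattice a b \<Longrightarrow> - l \<in> lattice a b"
  using lattice_diff[OF _ zero_in_lattice] by simp

lemma strict_voronoi0_minus:
  assumes "p \<in> strict_voronoi0 a b"
  shows "- p \<in> strict_voronoi0 a b"
  unfolding strict_voronoi0_def
proof safe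
  fix l assume "l \<in> lattice a b" "l \<noteq> 0"
  then have "- l \<in> lattice a b" "- l \<noteq> 0" using lattice_minus by auto
  then have "p \<bullet> (- l) < ((- l) \<bullet> (- l)) / 2"
    using assms unfolding strict_voronoi0_def by blast
  then show "(- p) \<bullet> l < (l \<bullet> l) / 2" by simp
qed

lemma voronoi0_minus:
  assumes "p \<in> voronoi0 a b"
  shows "- p \<in> voronoi0 a b"
  unfolding voronoi0_iff
proof
  fix l assume "l \<in> lattice a b"
  then have "p \<bullet> (- l) \<le> ((- l) \<bullet> (- l)) / 2"
    using assms lattice_minus unfolding voronoi0_iff by blast
  then show "(- p) \<bullet> l \<le> (l \<bullet> l) / 2" by simp
qed

lemma strict_voronoi0_subset: "strict_voronoi0 a b \<subseteq> voronoi0 a b"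
proof
  fix p assume p: "p \<in> strict_voronoi0 a b"
  show "p \<in> voronoi0 a b" unfolding voronoi0_iff
  proof
    fix l assume "l \<in> lattice a b"
    then show "p \<bullet> l \<le> (l \<bullet> l) / 2"
      using p by (cases "l = 0") (auto simp: strict_voronoi0_def less_imp_le)
  qed
qed

lemma strict_voronoi0_nearest:
  assumes "x - l \<in> strict_voronoi0 a b" "l \<in> lattice a b" "m \<in> lattice a b" "m \<noteq> l"
  shows "dist x l < dist x m"
proof -
  have "m - l \<in> lattice a b" "m - l \<noteq> 0" using assms lattice_diff by auto
  then have "(x - l) \<bullet> (m - l) < ((m - l) \<bullet> (m - l)) / 2"
    using assms(1) unfolding strict_voronoi0_def by blast
  then have "dist (x - l) 0 < dist (x - l) (m - l)" unfolding dist_le_dist_iff .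
  then show ?thesis by (simp add: dist_norm)
qed

text \<open>Neighbouring relevant vectors enclose an acute angle and every lattice vector is a
  nonnegative integer combination of two neighbours, so that \<open>m \<le> m\<^sup>2\<close> for the coefficients
  reduces all Voronoi inequalities to the six relevant ones.\<close>

lemma acute_cone_bound:
  fixes p s t :: "'a::real_inner" and m n :: nat
  assumes "0 \<le> s \<bullet> t" and l: "l = real m *\<^sub>R s + real n *\<^sub>R t"
  shows "p \<bullet> l - (l \<bullet> l) / 2 \<le> real m * (p \<bullet> s - (s \<bullet> s) / 2) + real n * (p \<bullet> t - (t \<bullet> t) / 2)"
proof -
  have sq: "real k * c \<le> real k * (real k * c)" if "0 \<le> c" for k :: nat and c
  proof (cases k)
    case (Suc j)
    then have "1 * (real k * c) \<le> real k * (real k * c)" using that by (intro mult_right_mono) auto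
    then show ?thesis by simp
  qed simp
  have "l \<bullet> l = real m * (real m * (s \<bullet> s)) + real n * (real n * (t \<bullet> t)) + 2 * (real m * real n * (s \<bullet> t))"
    unfolding l by (simp add: inner_add inner_commute algebra_simps)
  moreover have "0 \<le> real m * real n * (s \<bullet> t)" using assms by simp
  ultimately have "real m * (s \<bullet> s) + real n * (t \<bullet> t) \<le> l \<bullet> l"
    using sq[of "s \<bullet> s" m, OF inner_ge_zero] sq[of "t \<bullet> t" n, OF inner_ge_zero] by linarith
  moreover have "p \<bullet> l = real m * (p \<bullet> s) + real n * (p \<bullet> t)"
    unfolding l by (simp add: inner_add)
  ultimately show ?thesis by (simp add: algebra_simps)
qed

section \<open>Reduction to six inequalities; the upper and central rectangles against the
  hexagon\<close>

text \<open>\<open>ab\<close> says that (a, b) and (a - 1, b) have positive inner product; by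
  \<open>b_tau1\<close> it also amounts to \<open>tau1 a b > 0\<close>. It is where \<rho> \<ge> 1
  enters.\<close>

locale obtuse =
  fixes a b :: real
  assumes a_pos: "0 < a" and a_less: "a < 1" and b_pos: "0 < b" and ab: "a * (1 - a) < b * b"
begin

lemma lattice_acute_cone:
  assumes "l \<in> lattice a b"
  shows "\<exists>s\<in>relevant a b. \<exists>t\<in>relevant a b. \<exists>m n :: nat.
    0 \<le> s \<bullet> t \<and> l = real m *\<^sub>R s + real n *\<^sub>R t"
proof -
  obtain u v where l: "l = (of_int u + of_int v * a, of_int v * b)"
    using assms by (auto simp: lattice_def)
  have dots: "0 \<le> (a, b) \<bullet> (a - 1, b)" "0 \<le> (-a, -b) \<bullet> (1 - a, -b)"
    "0 \<le> (1, 0::real) \<bullet> (a, b)" "0 \<le> (-1, 0::real) \<bullet> (-a, -b)"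
    "0 \<le> (a - 1, b) \<bullet> (-1, 0::real)" "0 \<le> (1 - a, -b) \<bullet> (1, 0::real)"
    using a_pos a_less ab by (auto simp: algebra_simps)
  have ex: ?thesis
    if "s \<in> relevant a b" "t \<in> relevant a b" "0 \<le> s \<bullet> t" "0 \<le> i" "0 \<le> j"
      "l = of_int i *\<^sub>R s + of_int j *\<^sub>R t" for s t i j
    using that by (intro bexI[of _ s] bexI[of _ t] exI[of _ "nat i"] exI[of _ "nat j"]) auto
  \<comment> \<open>The lines spanned by (1, 0), (a, b) and (a - 1, b) are v = 0, u = 0 and u + v =
    0, so these signs tell which of the six sectors contains \<open>l\<close>.\<close>
  consider "0 \<le> v" "0 \<le> u" | "0 \<le> v" "u < 0" "0 \<le> u + v" | "0 \<le> v" "u + v < 0"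
    | "v < 0" "u \<le> 0" | "v < 0" "0 < u" "u + v \<le> 0" | "v < 0" "0 < u + v"
    by linarith
  then show ?thesis
  proof cases
    case 1 show ?thesis
      by (rule ex[of "(1,0)" "(a,b)" u v]) (use 1 dots in \<open>auto simp: relevant_def l\<close>)
  next
    case 2 show ?thesis
      by (rule ex[of "(a,b)" "(a-1,b)" "u+v" "-u"])
        (use 2 dots in \<open>auto simp: relevant_def l algebra_simps\<close>)
  next
    case 3 show ?thesis
      by (rule ex[of "(a-1,b)" "(-1,0)" v "-(u+v)"])
        (use 3 dots in \<open>auto simp: relevant_def l algebra_simps\<close>)
  next
    case 4 show ?thesis
      by (rule ex[of "(-1,0)" "(-a,-b)" "-u" "-v"])
        (use 4 dots in \<open>auto simp: relevant_def l algebra_simps\<close>)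
  next
    case 5 show ?thesis
      by (rule ex[of "(-a,-b)" "(1-a,-b)" "-(u+v)" u])
        (use 5 dots in \<open>auto simp: relevant_def l algebra_simps\<close>)
  next
    case 6 show ?thesis
      by (rule ex[of "(1-a,-b)" "(1,0)" "-v" "u+v"])
        (use 6 dots in \<open>auto simp: relevant_def l algebra_simps\<close>)
  qed
qed

lemma voronoi0I:
  assumes "\<And>s. s \<in> relevant a b \<Longrightarrow> p \<bullet> s \<le> (s \<bullet> s) / 2"
  shows "p \<in> voronoi0 a b"
  unfolding voronoi0_iff
proof
  fix l assume "l \<in> lattice a b"
  then obtain s t m n where *: "s \<in> relevant a b" "t \<in> relevant a b" "0 \<le> s \<bullet> t"
    and l: "l = real m *\<^sub>R s + real n *\<^sub>R t"
    using lattice_acute_cone by blast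
  have "real m * (p \<bullet> s - (s \<bullet> s) / 2) \<le> 0" "real n * (p \<bullet> t - (t \<bullet> t) / 2) \<le> 0"
    using assms[OF *(1)] assms[OF *(2)] by (simp_all add: mult_nonneg_nonpos)
  then show "p \<bullet> l \<le> (l \<bullet> l) / 2" using acute_cone_bound[OF *(3) l, of p] by linarith
qed

lemma strict_voronoi0I:
  assumes "\<And>s. s \<in> relevant a b \<Longrightarrow> p \<bullet> s < (s \<bullet> s) / 2"
  shows "p \<in> strict_voronoi0 a b"
  unfolding strict_voronoi0_def
proof safe
  fix l assume "l \<in> lattice a b" "l \<noteq> 0"
  then obtain s t and m n :: nat where *: "s \<in> relevant a b" "t \<in> relevant a b" "0 \<le> s \<bullet> t"
    and l: "l = real m *\<^sub>R s + real n *\<^sub>R t"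
    using lattice_acute_cone by blast
  have le: "real m * (p \<bullet> s - (s \<bullet> s) / 2) \<le> 0" "real n * (p \<bullet> t - (t \<bullet> t) / 2) \<le> 0"
    using assms[OF *(1)] assms[OF *(2)] by (simp_all add: mult_nonneg_nonpos)
  have "m > 0 \<or> n > 0" using l \<open>l \<noteq> 0\<close> by auto
  then have "real m * (p \<bullet> s - (s \<bullet> s) / 2) < 0 \<or> real n * (p \<bullet> t - (t \<bullet> t) / 2) < 0"
    using assms[OF *(1)] assms[OF *(2)] by (auto intro!: mult_pos_neg)
  then show "p \<bullet> l < (l \<bullet> l) / 2" using le acute_cone_bound[OF *(3) l, of p] by linarith
qed

lemma b_tau1: "b * tau1 a b = (b * b - a * (1 - a)) / 2"
  using b_pos by (simp add: tau1_def field_simps)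

lemma tau1_bounds: "0 < tau1 a b" "tau1 a b < b / 2"
proof -
  show "0 < tau1 a b" using b_tau1 ab b_pos by (metis diff_gt_0_iff_gt half_gt_zero zero_less_mult_pos)
  show "tau1 a b < b / 2" using a_pos a_less b_pos by (simp add: tau1_def)
qed

text \<open>With \<open>a * p1\<close> and \<open>b * p2\<close> as atoms the relevant inequalities
  become linear; the cell lemmas below then only need bounds on these products.\<close>

lemma hexagon_voronoi0I:
  assumes "-1/2 \<le> p1" "p1 \<le> 1/2"
    "- (a * a + b * b) / 2 \<le> a * p1 + b * p2" "a * p1 + b * p2 \<le> (a * a + b * b) / 2"
    "- (1 - 2 * a + a * a + b * b) / 2 \<le> p1 - a * p1 - b * p2"
    "p1 - a * p1 - b * p2 \<le> (1 - 2 * a + a * a + b * b) / 2"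
  shows "(p1, p2) \<in> voronoi0 a b"
proof (rule voronoi0I)
  fix s assume s: "s \<in> relevant a b"
  have ip: "(p1, p2) \<bullet> (1, 0) = p1" "(p1, p2) \<bullet> (-1, 0) = - p1"
    "(1 :: real, 0 :: real) \<bullet> (1, 0) = 1" "(-1 :: real, 0 :: real) \<bullet> (-1, 0) = 1"
    "(a, b) \<bullet> (a, b) = a * a + b * b" "(- a, - b) \<bullet> (- a, - b) = a * a + b * b"
    "(p1, p2) \<bullet> (a - 1, b) = a * p1 - p1 + b * p2"
    "(p1, p2) \<bullet> (1 - a, - b) = p1 - a * p1 - b * p2"
    "(p1, p2) \<bullet> (a, b) = a * p1 + b * p2" "(p1, p2) \<bullet> (- a, - b) = - (a * p1) - b * p2"
    "(a - 1, b) \<bullet> (a - 1, b) = 1 - 2 * a + a * a + b * b"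
    "(1 - a, - b) \<bullet> (1 - a, - b) = 1 - 2 * a + a * a + b * b"
    by (simp_all add: algebra_simps)
  show "(p1, p2) \<bullet> s \<le> (s \<bullet> s) / 2"
    using s unfolding relevant_def
    by (elim insertE emptyE; hypsubst; unfold ip; use assms in linarith)
qed

lemma hexagon_strict_voronoi0I:
  assumes "-1/2 < p1" "p1 < 1/2"
    "- (a * a + b * b) / 2 < a * p1 + b * p2" "a * p1 + b * p2 < (a * a + b * b) / 2"
    "- (1 - 2 * a + a * a + b * b) / 2 < p1 - a * p1 - b * p2"
    "p1 - a * p1 - b * p2 < (1 - 2 * a + a * a + b * b) / 2"
  shows "(p1, p2) \<in> strict_voronoi0 a b"
proof (rule strict_voronoi0I)
  fix s assume s: "s \<in> relevant a b"
  have ip: "(p1, p2) \<bullet> (1, 0) = p1" "(p1, p2) \<bullet> (-1, 0) = - p1"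
    "(1 :: real, 0 :: real) \<bullet> (1, 0) = 1" "(-1 :: real, 0 :: real) \<bullet> (-1, 0) = 1"
    "(a, b) \<bullet> (a, b) = a * a + b * b" "(- a, - b) \<bullet> (- a, - b) = a * a + b * b"
    "(p1, p2) \<bullet> (a - 1, b) = a * p1 - p1 + b * p2"
    "(p1, p2) \<bullet> (1 - a, - b) = p1 - a * p1 - b * p2"
    "(p1, p2) \<bullet> (a, b) = a * p1 + b * p2" "(p1, p2) \<bullet> (- a, - b) = - (a * p1) - b * p2"
    "(a - 1, b) \<bullet> (a - 1, b) = 1 - 2 * a + a * a + b * b"
    "(1 - a, - b) \<bullet> (1 - a, - b) = 1 - 2 * a + a * a + b * b"
    by (simp_all add: algebra_simps)
  show "(p1, p2) \<bullet> s < (s \<bullet> s) / 2"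
    using s unfolding relevant_def
    by (elim insertE emptyE; hypsubst; unfold ip; use assms in linarith)
qed

text \<open>The bounds on \<open>p1\<close> are multiplied by the positive numbers a and 1 - a. The
  names \<open>al\<close>, \<open>au\<close> let the caller supply the products already
  expanded.\<close>

lemma strip_bounds:
  assumes "l < p1" "p1 < u" "a * l = al" "a * u = au"
  shows "al < a * p1" "a * p1 < au" "l - al < p1 - a * p1" "p1 - a * p1 < u - au"
proof -
  show "al < a * p1" "a * p1 < au" using assms a_pos by auto
  have "(1 - a) * l < (1 - a) * p1" "(1 - a) * p1 < (1 - a) * u"
    using assms a_less by simp_all
  then show "l - al < p1 - a * p1" "p1 - a * p1 < u - au" 
    unfolding assms(3,4)[symmetric] by (simp_all add: left_diff_distrib)
qed

lemma upper_strip_bounds: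
  assumes "tau1 a b < p2" "p2 < b / 2"
  shows "b * b - a + a * a < 2 * (b * p2)" "2 * (b * p2) < b * b" "0 < b * p2"
proof -
  have "b * tau1 a b < b * p2" "b * p2 < b * (b / 2)" using assms b_pos by auto
  moreover have "0 < b * p2" using assms b_pos tau1_bounds by auto
  ultimately show "b * b - a + a * a < 2 * (b * p2)" "2 * (b * p2) < b * b" "0 < b * p2"
    unfolding b_tau1 by (simp_all add: right_diff_distrib)
qed

lemma parameter_bounds: "0 < a * a" "0 < 1 - 2 * a + a * a" "a * a < a" "a - a * a < b * b"
proof -
  have "0 < (1 - a) * (1 - a)" "0 < a * (1 - a)" using a_pos a_less by simp_all
  then show "0 < 1 - 2 * a + a * a" "a * a < a" by (simp_all add: algebra_simps)
  show "0 < a * a" "a - a * a < b * b" using a_pos ab by (simp_all add: right_diff_distrib)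
qed

text \<open>By \<open>b_tau1\<close> the bisectors of (a, b) and (a - 1, b) pass through (1/2,
  \<open>tau1\<close>) and (-1/2, \<open>tau1\<close>); inside the central rectangle all relevant
  inequalities are therefore strict.\<close>

lemma central_strict:
  assumes "\<bar>p1\<bar> < 1/2" "\<bar>p2\<bar> < tau1 a b"
  shows "(p1, p2) \<in> strict_voronoi0 a b"
proof -
  have p: "-1/2 < p1" "p1 < 1/2" using assms by auto
  have "\<bar>b * p2\<bar> < b * tau1 a b" using assms b_pos by (simp add: abs_mult)
  then have 1: "- (b * b - a + a * a) / 2 < b * p2" "b * p2 < (b * b - a + a * a) / 2"
    unfolding b_tau1 by (simp_all add: abs_less_iff right_diff_distrib)
  note 2 = strip_bounds[OF p, of "-a/2" "a/2", simplified]
  show ?thesis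
  proof (rule hexagon_strict_voronoi0I)
    show "-1/2 < p1" "p1 < 1/2" by (fact p)+
    show "- (a * a + b * b) / 2 < a * p1 + b * p2" using 1(1) 2(1) by argo
    show "a * p1 + b * p2 < (a * a + b * b) / 2" using 1(2) 2(2) by argo
    show "- (1 - 2 * a + a * a + b * b) / 2 < p1 - a * p1 - b * p2" using 1(2) 2(3) by argo
    show "p1 - a * p1 - b * p2 < (1 - 2 * a + a * a + b * b) / 2" using 1(1) 2(4) by argo
  qed
qed

text \<open>The bisectors of (a, b) and (a - 1, b) reach height b/2 at a/2 and (a - 1)/2, so between
  these abscissae the strip stays below both.\<close>

lemma upper_middle_strict:
  assumes "(a - 1) / 2 < p1" "p1 < a / 2" "tau1 a b < p2" "p2 < b / 2"
  shows "(p1, p2) \<in> strict_voronoi0 a b"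
proof -
  have e: "a * ((a - 1) / 2) = a * a / 2 - a / 2" "a * (a / 2) = a * a / 2" by (simp_all add: field_simps)
  note x = strip_bounds[OF assms(1,2) e] and y = upper_strip_bounds[OF assms(3,4)]
    and P = parameter_bounds
  show ?thesis
  proof (rule hexagon_strict_voronoi0I)
    show "-1/2 < p1" using assms(1) a_pos by argo
    show "p1 < 1/2" using assms(2) a_less by argo
    show "- (a * a + b * b) / 2 < a * p1 + b * p2" using x(1) y(1) P(1,4) by argo
    show "a * p1 + b * p2 < (a * a + b * b) / 2" using x(2) y(2) by argo
    show "- (1 - 2 * a + a * a + b * b) / 2 < p1 - a * p1 - b * p2" using x(3) y(2) by argo
    show "p1 - a * p1 - b * p2 < (1 - 2 * a + a * a + b * b) / 2" using x(4) y(1) P(2,4) by argo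
  qed
qed

text \<open>Of the six relevant bisectors only that of \<open>n\<close> crosses this cell, so its
  inequality alone separates the cases. On the far side it turns into the inequality for
  \<open>- n\<close> at the point shifted by \<open>- n\<close>; the other five hold there by the
  bounds of the strip.\<close>

lemma upper_left_cell:
  assumes "-1/2 < p1" "p1 < (a - 1) / 2" "tau1 a b < p2" "p2 < b / 2"
  defines "n \<equiv> (a - 1, b)"
  shows "(p1, p2) \<bullet> n \<le> (n \<bullet> n) / 2 \<Longrightarrow> (p1, p2) \<in> voronoi0 a b"
    and "(p1, p2) \<bullet> n < (n \<bullet> n) / 2 \<Longrightarrow> (p1, p2) \<in> strict_voronoi0 a b"
    and "(p1, p2) \<bullet> n > (n \<bullet> n) / 2 \<Longrightarrow> (p1, p2) - n \<in> strict_voronoi0 a b"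
proof -
  have n: "(p1, p2) \<bullet> n = b * p2 - (p1 - a * p1)" "n \<bullet> n = 1 - 2 * a + a * a + b * b"
    by (simp_all add: n_def field_simps)
  have e: "a * (-1/2) = - a / 2" "a * ((a - 1) / 2) = a * a / 2 - a / 2" by (simp_all add: field_simps)
  have t: "(p1, p2) - n = (p1 + 1 - a, p2 - b)"
    "a * (p1 + 1 - a) = a * p1 + a - a * a" "b * (p2 - b) = b * p2 - b * b" by (simp_all add: n_def algebra_simps)
  note x = strip_bounds[OF assms(1,2) e] and y = upper_strip_bounds[OF assms(3,4)]
    and P = parameter_bounds
  show "(p1, p2) \<in> voronoi0 a b" if H: "(p1, p2) \<bullet> n \<le> (n \<bullet> n) / 2"
  proof (rule hexagon_voronoi0I)
    show "-1/2 \<le> p1" using assms(1) by argo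
    show "p1 \<le> 1/2" using assms(2) a_less by argo
    show "- (a * a + b * b) / 2 \<le> a * p1 + b * p2" using x(1) y(1) P(4) by argo
    show "a * p1 + b * p2 \<le> (a * a + b * b) / 2" using x(2) y(2) a_pos by argo
    show "- (1 - 2 * a + a * a + b * b) / 2 \<le> p1 - a * p1 - b * p2" using H unfolding n by (simp add: field_simps)
    show "p1 - a * p1 - b * p2 \<le> (1 - 2 * a + a * a + b * b) / 2" using x(4) y(1) P(2,4) a_less by argo
  qed
  show "(p1, p2) \<in> strict_voronoi0 a b" if H: "(p1, p2) \<bullet> n < (n \<bullet> n) / 2"
  proof (rule hexagon_strict_voronoi0I)
    show "-1/2 < p1" using assms(1) by argo
    show "p1 < 1/2" using assms(2) a_less by argo
    show "- (a * a + b * b) / 2 < a * p1 + b * p2" using x(1) y(1) P(4) by argo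
    show "a * p1 + b * p2 < (a * a + b * b) / 2" using x(2) y(2) a_pos by argo
    show "- (1 - 2 * a + a * a + b * b) / 2 < p1 - a * p1 - b * p2" using H unfolding n by (simp add: field_simps)
    show "p1 - a * p1 - b * p2 < (1 - 2 * a + a * a + b * b) / 2" using x(4) y(1) P(2,4) a_less by argo
  qed
  show "(p1, p2) - n \<in> strict_voronoi0 a b" if H: "(p1, p2) \<bullet> n > (n \<bullet> n) / 2"
    unfolding t
  proof (rule hexagon_strict_voronoi0I)
    show "-1/2 < (p1 + 1 - a)" using assms(1) a_less unfolding t by argo
    show "(p1 + 1 - a) < 1/2" using assms(2) a_pos unfolding t by argo
    show "- (a * a + b * b) / 2 < a * (p1 + 1 - a) + b * (p2 - b)" using x(1) y(1) unfolding t by argo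
    show "a * (p1 + 1 - a) + b * (p2 - b) < (a * a + b * b) / 2" using x(2) y(2) P(4) a_pos unfolding t by argo
    show "- (1 - 2 * a + a * a + b * b) / 2 < (p1 + 1 - a) - a * (p1 + 1 - a) - b * (p2 - b)" using x(3) y(2) P(2,4) a_less unfolding t by argo
    show "(p1 + 1 - a) - a * (p1 + 1 - a) - b * (p2 - b) < (1 - 2 * a + a * a + b * b) / 2" using H unfolding n t by (simp add: field_simps)
  qed
qed

lemma upper_right_cell:
  assumes "a / 2 < p1" "p1 < 1/2" "tau1 a b < p2" "p2 < b / 2"
  defines "n \<equiv> (a, b)"
  shows "(p1, p2) \<bullet> n \<le> (n \<bullet> n) / 2 \<Longrightarrow> (p1, p2) \<in> voronoi0 a b"
    and "(p1, p2) \<bullet> n < (n \<bullet> n) / 2 \<Longrightarrow> (p1, p2) \<in> strict_voronoi0 a b"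
    and "(p1, p2) \<bullet> n > (n \<bullet> n) / 2 \<Longrightarrow> (p1, p2) - n \<in> strict_voronoi0 a b"
proof -
  have n: "(p1, p2) \<bullet> n = a * p1 + b * p2" "n \<bullet> n = a * a + b * b"
    by (simp_all add: n_def field_simps)
  have e: "a * (a / 2) = a * a / 2" "a * (1/2) = a / 2" by (simp_all add: field_simps)
  have t: "(p1, p2) - n = (p1 - a, p2 - b)"
    "a * (p1 - a) = a * p1 - a * a" "b * (p2 - b) = b * p2 - b * b" by (simp_all add: n_def algebra_simps)
  note x = strip_bounds[OF assms(1,2) e] and y = upper_strip_bounds[OF assms(3,4)]
    and P = parameter_bounds
  show "(p1, p2) \<in> voronoi0 a b" if H: "(p1, p2) \<bullet> n \<le> (n \<bullet> n) / 2"
  proof (rule hexagon_voronoi0I)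
    show "-1/2 \<le> p1" using assms(1) a_pos by argo
    show "p1 \<le> 1/2" using assms(2) by argo
    show "- (a * a + b * b) / 2 \<le> a * p1 + b * p2" using x(1) y(3) P(1,3,4) by argo
    show "a * p1 + b * p2 \<le> (a * a + b * b) / 2" using H unfolding n by (simp add: field_simps)
    show "- (1 - 2 * a + a * a + b * b) / 2 \<le> p1 - a * p1 - b * p2" using x(3) y(2) a_less by argo
    show "p1 - a * p1 - b * p2 \<le> (1 - 2 * a + a * a + b * b) / 2" using x(4) y(1) P(4) by argo
  qed
  show "(p1, p2) \<in> strict_voronoi0 a b" if H: "(p1, p2) \<bullet> n < (n \<bullet> n) / 2"
  proof (rule hexagon_strict_voronoi0I)
    show "-1/2 < p1" using assms(1) a_pos by argo
    show "p1 < 1/2" using assms(2) by argo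
    show "- (a * a + b * b) / 2 < a * p1 + b * p2" using x(1) y(3) P(1,3,4) by argo
    show "a * p1 + b * p2 < (a * a + b * b) / 2" using H unfolding n by (simp add: field_simps)
    show "- (1 - 2 * a + a * a + b * b) / 2 < p1 - a * p1 - b * p2" using x(3) y(2) a_less by argo
    show "p1 - a * p1 - b * p2 < (1 - 2 * a + a * a + b * b) / 2" using x(4) y(1) P(4) by argo
  qed
  show "(p1, p2) - n \<in> strict_voronoi0 a b" if H: "(p1, p2) \<bullet> n > (n \<bullet> n) / 2"
    unfolding t
  proof (rule hexagon_strict_voronoi0I)
    show "-1/2 < (p1 - a)" using assms(1) a_less unfolding t by argo
    show "(p1 - a) < 1/2" using assms(2) a_pos unfolding t by argo
    show "- (a * a + b * b) / 2 < a * (p1 - a) + b * (p2 - b)" using H unfolding n t by (simp add: field_simps)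
    show "a * (p1 - a) + b * (p2 - b) < (a * a + b * b) / 2" using x(2) y(2) P(1,4) a_pos unfolding t by argo
    show "- (1 - 2 * a + a * a + b * b) / 2 < (p1 - a) - a * (p1 - a) - b * (p2 - b)" using x(3) y(2) P(4) a_less unfolding t by argo
    show "(p1 - a) - a * (p1 - a) - b * (p2 - b) < (1 - 2 * a + a * a + b * b) / 2" using x(4) y(1) unfolding t by argo
  qed
qed

end

section \<open>Halving a rectangle along whose diagonal a line runs\<close>

definition bisector :: "pt \<Rightarrow> pt set" where
  "bisector n = {p. p \<bullet> n = (n \<bullet> n) / 2}"

definition meets :: "pt set \<Rightarrow> rect \<Rightarrow> bool" where
  "meets F r \<longleftrightarrow> interior (rect_set r) \<inter> F \<noteq> {}"

definition proper :: "rect \<Rightarrow> bool" where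
  "proper r \<longleftrightarrow> fst (fst r) < snd (fst r) \<and> fst (snd r) < snd (snd r)"

text \<open>Closed at the upper ends because \<open>halve_iv\<close> assigns the midpoint to the
  lower half. The four quarters then partition the rectangle exactly, with no null sets to discard
  in the induction.\<close>

definition half_open :: "rect \<Rightarrow> pt set" where
  "half_open r = {fst (fst r)<..snd (fst r)} \<times> {fst (snd r)<..snd (snd r)}"

definition area :: "rect \<Rightarrow> real" where
  "area r = (snd (fst r) - fst (fst r)) * (snd (snd r) - fst (snd r))"

text \<open>A line through the centre with this ratio of sides contains two opposite corners.
  Absolute values let one formula serve rising and falling diagonals.\<close>

definition diagonal :: "pt \<Rightarrow> rect \<Rightarrow> bool" where
  "diagonal n r \<longleftrightarrow> fst n \<noteq> 0 \<and> snd n \<noteq> 0 \<and>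
     ((fst (fst r) + snd (fst r)) / 2, (fst (snd r) + snd (snd r)) / 2) \<in> bisector n \<and>
     \<bar>fst n\<bar> * (snd (fst r) - fst (fst r)) = \<bar>snd n\<bar> * (snd (snd r) - fst (snd r))"

lemma interior_rect_set:
  "interior (rect_set r) = {fst (fst r)<..<snd (fst r)} \<times> {fst (snd r)<..<snd (snd r)}"
  by (simp add: rect_set_def interior_Times)

lemma rect_set_halve_subset: "rect_set (halve x r) \<subseteq> rect_set r"
  by (auto simp: rect_set_def halve_def halve_iv_def Let_def)

lemma rect_set_funpow_halve_subset: "rect_set ((halve x ^^ k) r) \<subseteq> rect_set r"
proof (induction k)
  case (Suc k)
  then show ?case using rect_set_halve_subset[of x "(halve x ^^ k) r"] by auto
qed simp

lemma mem_rect_set_halve: "x \<in> rect_set r \<Longrightarrow> x \<in> rect_set (halve x r)"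
  by (auto simp: rect_set_def halve_def halve_iv_def Let_def)

lemma mem_rect_set_funpow_halve: "x \<in> rect_set r \<Longrightarrow> x \<in> rect_set ((halve x ^^ k) r)"
  by (induction k) (auto intro: mem_rect_set_halve)

lemma proper_halve: "proper r \<Longrightarrow> proper (halve x r)"
  by (auto simp: proper_def halve_def halve_iv_def Let_def)

lemma proper_funpow_halve: "proper r \<Longrightarrow> proper ((halve x ^^ k) r)"
  by (induction k) (auto intro: proper_halve)

lemma meets_funpow_halveD: "meets F ((halve x ^^ k) r) \<Longrightarrow> meets F r"
  using interior_mono[OF rect_set_funpow_halve_subset[of k x r]] by (auto simp: meets_def)

text \<open>No condition on \<Phi> is imposed: from a fixed \<open>r\<close> only finitely many
  rectangles arise, each on a set cut out by comparing coordinates with fixed midpoints. The first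
  halving is peeled off, not the last, so that every case restarts from a fixed rectangle.\<close>

lemma measurable_funpow_halve:
  "{x. \<Phi> ((halve x ^^ k) r)} \<in> sets (borel :: pt measure)"
proof (induction k arbitrary: r)
  case (Suc k)
  define m m' where "m = (fst (fst r) + snd (fst r)) / 2" and "m' = (fst (snd r) + snd (snd r)) / 2"
  define A B where "A = {x::pt. fst x \<le> m}" and "B = {x::pt. snd x \<le> m'}"
  have AB: "A \<in> sets borel" "B \<in> sets borel" unfolding A_def B_def
    by (intro borel_closed closed_Collect_le continuous_intros)+
  define S where "S = (\<lambda>q. {x. \<Phi> ((halve x ^^ k) q)})"
  have S: "S q \<in> sets borel" for q using Suc by (simp add: S_def)
  have "{x. \<Phi> ((halve x ^^ Suc k) r)}
      = (A \<inter> B \<inter> S ((fst (fst r), m), (fst (snd r), m'))) \<union> (A \<inter> - B \<inter> S ((fst (fst r), m), (m', snd (snd r))))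
      \<union> (- A \<inter> B \<inter> S ((m, snd (fst r)), (fst (snd r), m'))) \<union> (- A \<inter> - B \<inter> S ((m, snd (fst r)), (m', snd (snd r))))"
    unfolding funpow_Suc_right o_def
    by (auto simp: halve_def halve_iv_def Let_def m_def m'_def A_def B_def S_def)
  also have "\<dots> \<in> sets borel"
    by (intro sets.Un sets.Int borel_comp AB S)
  finally show ?case .
qed simp

text \<open>Squeezing between the open and the closed box covers both orientations in use:
  \<open>babai_cell\<close> is closed below, \<open>half_open\<close> is closed above.\<close>

lemma emeasure_lborel_rect:
  assumes "l \<le> u" "l' \<le> u'" "S \<in> sets borel"
    and "{l<..<u} \<times> {l'<..<u'} \<subseteq> S" "S \<subseteq> {l..u} \<times> {l'..u'}"
  shows "emeasure lborel S = ennreal ((u - l) * (u' - l'))"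
proof -
  have "emeasure lborel ({l<..<u} \<times> {l'<..<u'}) = ennreal ((u - l) * (u' - l'))"
    unfolding lborel_prod[symmetric]
    using assms by (subst lborel.emeasure_pair_measure_Times) (auto simp: ennreal_mult)
  moreover have "emeasure lborel ({l..u} \<times> {l'..u'}) = ennreal ((u - l) * (u' - l'))"
    unfolding lborel_prod[symmetric]
    using assms by (subst lborel.emeasure_pair_measure_Times) (auto simp: ennreal_mult)
  moreover have "{l..u} \<times> {l'..u'} \<in> sets borel"
    by (intro borel_closed closed_Times) auto
  ultimately show ?thesis
    using emeasure_mono[OF assms(4), of lborel] emeasure_mono[OF assms(5), of lborel] assms(3)
    by (simp add: antisym)
qed

lemma emeasure_half_open:
  assumes "proper r"
  shows "emeasure lborel (half_open r) = ennreal (area r)"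
  unfolding area_def using assms
  by (intro emeasure_lborel_rect) (auto simp: proper_def half_open_def borel_Times)

lemma half_open_measurable [measurable]: "half_open r \<in> sets borel"
  by (simp add: half_open_def borel_Times)

lemma diagonal_meets:
  assumes "proper r" "diagonal n r"
  shows "meets (bisector n) r"
proof -
  have "((fst (fst r) + snd (fst r)) / 2, (fst (snd r) + snd (snd r)) / 2) \<in> interior (rect_set r)"
    using assms by (simp add: interior_rect_set proper_def)
  then show ?thesis using assms unfolding meets_def diagonal_def by blast
qed

lemma halve_diagonal:
  assumes "proper r" "diagonal n r"
  obtains q q' where "proper q" "proper q'" "diagonal n q" "diagonal n q'"
    "area q = area r / 4" "area q' = area r / 4" "half_open q \<inter> half_open q' = {}"
    "half_open q \<union> half_open q' \<subseteq> half_open r"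
    "\<And>x. x \<in> half_open q \<Longrightarrow> halve x r = q" "\<And>x. x \<in> half_open q' \<Longrightarrow> halve x r = q'"
    "\<And>x. x \<in> half_open r \<Longrightarrow> x \<notin> half_open q \<Longrightarrow> x \<notin> half_open q' \<Longrightarrow>
      \<not> meets (bisector n) (halve x r)"
proof -
  obtain l u l' u' where r: "r = ((l, u), (l', u'))" by (metis prod.collapse)
  obtain n1 n2 where n: "n = (n1, n2)" by (metis prod.collapse)
  define m m' where "m = (l + u) / 2" and "m' = (l' + u') / 2"
  have lu: "l < m" "m < u" "l' < m'" "m' < u'"
    using assms(1) by (auto simp: r proper_def m_def m'_def)
  define w h where "w = m - l" and "h = m' - l'"
  have wh: "0 < w" "0 < h" using lu by (auto simp: w_def h_def)
  have um: "u - m = w" "u' - m' = h" "u - l = 2 * w" "u' - l' = 2 * h"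
    "l - m = - w" "l' - m' = - h" using w_def h_def m_def m'_def by argo+
  have mid: "(l + m) / 2 - m = - w / 2" "(m + u) / 2 - m = w / 2"
    "(l' + m') / 2 - m' = - h / 2" "(m' + u') / 2 - m' = h / 2"
    using w_def h_def m_def m'_def by argo+
  have n0: "n1 \<noteq> 0" "n2 \<noteq> 0" and c: "m * n1 + m' * n2 = (n1 * n1 + n2 * n2) / 2"
    using assms(2) by (auto simp: r n diagonal_def bisector_def m_def m'_def)
  have d: "\<bar>n1\<bar> * w = \<bar>n2\<bar> * h"
    using assms(2) by (simp add: r n diagonal_def um)
  define LL LU UL UU where "LL = ((l, m), (l', m'))" and "LU = ((l, m), (m', u'))"
    and "UL = ((m, u), (l', m'))" and "UU = ((m, u), (m', u'))"
  note Q = LL_def LU_def UL_def UU_def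
  \<comment> \<open>In coordinates centred at (m, m') the bisector is a line through the
    origin.\<close>
  have on_line: "p \<in> bisector n \<longleftrightarrow> (fst p - m) * n1 + (snd p - m') * n2 = 0" for p
    using c by (cases p) (auto simp: bisector_def n left_diff_distrib)
  have pq: "proper LL" "proper LU" "proper UL" "proper UU"
    using lu by (auto simp: Q proper_def)
  have ar: "area LL = area r / 4" "area LU = area r / 4" "area UL = area r / 4" "area UU = area r / 4"
    by (simp_all add: Q area_def r um w_def[symmetric] h_def[symmetric])
  have hv: "halve x r = (if fst x \<le> m then if snd x \<le> m' then LL else LU
      else if snd x \<le> m' then UL else UU)" for x
    by (auto simp: halve_def halve_iv_def r Q m_def m'_def Let_def)
  have ho: "x \<in> half_open LL \<longleftrightarrow> x \<in> half_open r \<and> fst x \<le> m \<and> snd x \<le> m'"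
      "x \<in> half_open LU \<longleftrightarrow> x \<in> half_open r \<and> fst x \<le> m \<and> snd x > m'"
      "x \<in> half_open UL \<longleftrightarrow> x \<in> half_open r \<and> fst x > m \<and> snd x \<le> m'"
      "x \<in> half_open UU \<longleftrightarrow> x \<in> half_open r \<and> fst x > m \<and> snd x > m'" for x
    using lu by (auto simp: half_open_def r Q)
  \<comment> \<open>Two nonzero summands of equal sign cannot cancel. So the line avoids the open
    quarters in which the product of the centred coordinates has the sign of
    \<open>n1 * n2\<close>.\<close>
  have off: "x * n1 + y * n2 \<noteq> 0" if "0 < (x * n1) * (y * n2)" for x y
    using that by (metis add_pos_pos add_neg_neg less_irrefl zero_less_mult_iff)
  have offs: "x * n1 + y * n2 \<noteq> 0" if "0 < (x * y) * (n1 * n2)" for x y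
    using that by (intro off) (simp add: mult_ac)
  have off_line: "\<not> 0 < (fst p - m) * (snd p - m') * (n1 * n2)" if "p \<in> bisector n" for p
    using that offs on_line by blast
  consider (incr) "n1 * n2 < 0" | (decr) "n1 * n2 > 0"
    using n0 by (metis linorder_neqE_linordered_idom mult_eq_0_iff)
  then show ?thesis
  proof cases
    case incr
    \<comment> \<open>With the sign of \<open>n1 * n2\<close> known, \<open>d\<close> loses its
      absolute values; the result says that the centres of \<open>LL\<close> and \<open>UU\<close>
      lie on the line.\<close>
    have e: "w * n1 = - (h * n2)"
      using d incr by (auto simp: abs_if mult_less_0_iff mult.commute)
    have diag: "diagonal n LL" "diagonal n UU"
      unfolding diagonal_def on_line using d e n0
      by (simp_all add: Q n mid um w_def[symmetric] h_def[symmetric])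
    have "\<not> (fst p - m) * (snd p - m') < 0" if "p \<in> bisector n" for p
      using off_line[OF that] mult_neg_neg[OF _ incr] by blast
    then have "\<not> meets (bisector n) LU" "\<not> meets (bisector n) UL"
      unfolding meets_def interior_rect_set Q
      by (fastforce simp: not_less zero_le_mult_iff)+
    then show ?thesis
      using pq ar diag hv ho by (intro that[of LL UU]) auto
  next
    case decr
    have e: "w * n1 = h * n2"
      using d decr by (auto simp: abs_if zero_less_mult_iff mult.commute)
    have diag: "diagonal n LU" "diagonal n UL"
      unfolding diagonal_def on_line using d e n0
      by (simp_all add: Q n mid um w_def[symmetric] h_def[symmetric])
    have "\<not> (fst p - m) * (snd p - m') > 0" if "p \<in> bisector n" for p
      using off_line[OF that] mult_pos_pos[OF _ decr] by blast
    then have "\<not> meets (bisector n) LL" "\<not> meets (bisector n) UU"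
      unfolding meets_def interior_rect_set Q
      by (fastforce simp: not_less mult_le_0_iff)+
    then show ?thesis
      using pq ar diag hv ho by (intro that[of LU UL]) auto
  qed
qed

lemma emeasure_undecided:
  assumes "proper r" "diagonal n r"
  shows "emeasure lborel {x \<in> half_open r. meets (bisector n) ((halve x ^^ k) r)} = ennreal (area r / 2 ^ k)"
  using assms
proof (induction k arbitrary: r)
  case 0
  then show ?case using diagonal_meets emeasure_half_open by simp
next
  case (Suc k)
  show ?case
  proof (rule halve_diagonal[OF Suc.prems])
    fix q q' assume q: "proper q" "proper q'" "diagonal n q" "diagonal n q'"
      "area q = area r / 4" "area q' = area r / 4" "half_open q \<inter> half_open q' = {}"
      "half_open q \<union> half_open q' \<subseteq> half_open r"
      "\<And>x. x \<in> half_open q \<Longrightarrow> halve x r = q" "\<And>x. x \<in> half_open q' \<Longrightarrow> halve x r = q'"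
      "\<And>x. x \<in> half_open r \<Longrightarrow> x \<notin> half_open q \<Longrightarrow> x \<notin> half_open q' \<Longrightarrow>
        \<not> meets (bisector n) (halve x r)"
    define E where "E = (\<lambda>s. {x \<in> half_open s. meets (bisector n) ((halve x ^^ k) s)})"
    have [measurable]: "E s \<in> sets borel" for s
    proof -
      have "E s = half_open s \<inter> {x. meets (bisector n) ((halve x ^^ k) s)}" by (auto simp: E_def)
      then show ?thesis using measurable_funpow_halve[of "meets (bisector n)"] by auto
    qed
    have "0 \<le> area r" using Suc.prems(1) by (simp add: area_def proper_def)
    have "{x \<in> half_open r. meets (bisector n) ((halve x ^^ Suc k) r)} = E q \<union> E q'"
    proof (rule set_eqI)
      fix x
      show "x \<in> {x \<in> half_open r. meets (bisector n) ((halve x ^^ Suc k) r)} \<longleftrightarrow> x \<in> E q \<union> E q'"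
      proof (cases "x \<in> half_open q \<or> x \<in> half_open q'")
        case True
        then show ?thesis
          using q(7,8) q(9,10)[of x] unfolding E_def funpow_Suc_right o_def by auto
      next
        \<comment> \<open>The other two quarters miss the bisector after one halving, and later
          rectangles are subsets of them.\<close>
        case False
        then have "\<not> (x \<in> half_open r \<and> meets (bisector n) ((halve x ^^ k) (halve x r)))"
          using q(11) meets_funpow_halveD by blast
        then show ?thesis
          using False unfolding E_def funpow_Suc_right o_def by simp
      qed
    qed
    moreover have "E q \<inter> E q' = {}" using q(7) by (auto simp: E_def)
    ultimately have "emeasure lborel {x \<in> half_open r. meets (bisector n) ((halve x ^^ Suc k) r)}
        = emeasure lborel (E q) + emeasure lborel (E q')"
      by (simp add: plus_emeasure)
    also have "\<dots> = ennreal (area r / 4 / 2 ^ k + area r / 4 / 2 ^ k)"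
      unfolding E_def using Suc.IH[OF q(1,3)] Suc.IH[OF q(2,4)] q(5,6) \<open>0 \<le> area r\<close>
      by (subst ennreal_plus) auto
    also have "area r / 4 / 2 ^ k + area r / 4 / 2 ^ k = area r / 2 ^ Suc k" by simp
    finally show "emeasure lborel {x \<in> half_open r. meets (bisector n) ((halve x ^^ Suc k) r)}
        = ennreal (area r / 2 ^ Suc k)" .
  qed
qed

section \<open>Correct decisions on a rectangle crossed by one bisector\<close>

definition flip :: "rect \<Rightarrow> rect" where
  "flip r = ((- snd (fst r), - fst (fst r)), (- snd (snd r), - fst (snd r)))"

text \<open>The round-one rectangle as a function of the messages alone, for j = \<plusminus>1; see
  \<open>rect1_eq\<close>.\<close>

definition cell :: "real \<Rightarrow> real \<Rightarrow> int \<Rightarrow> int \<Rightarrow> rect" where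
  "cell a b j i = (if j = 1 then (Iint a i, Jint a b 1)
     else ((- snd (Iint a i), - fst (Iint a i)), Jint a b (- 1)))"

text \<open>The relevant vector whose bisector contains a diagonal of the cell with indices \<open>j\<close>, \<open>i\<close>
  (for \<open>j = \<plusminus>1\<close> and \<open>i = \<plusminus>1\<close>).\<close>

definition normal :: "real \<Rightarrow> real \<Rightarrow> int \<Rightarrow> int \<Rightarrow> pt" where
  "normal a b j i = (if j = 1 then (if i = 1 then (a, b) else (a - 1, b))
     else (if i = 1 then (- a, - b) else (1 - a, - b)))"

text \<open>The point \<open>x\<close> has its own clause because it may lie on an edge of
  \<open>q\<close>, where the statement about the interior is silent.\<close>

definition decided :: "real \<Rightarrow> real \<Rightarrow> pt \<Rightarrow> rect \<Rightarrow> bool" where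
  "decided a b x q \<longleftrightarrow> (\<exists>l\<in>lattice a b. x - l \<in> strict_voronoi0 a b \<and>
     (\<forall>y\<in>interior (rect_set q). y - l \<in> strict_voronoi0 a b))"

lemma decidedD:
  assumes "decided a b x q"
  shows "\<exists>l\<in>lattice a b. (\<forall>m\<in>lattice a b. m \<noteq> l \<longrightarrow> dist x l < dist x m) \<and>
    (\<forall>y\<in>interior (rect_set q). \<forall>m\<in>lattice a b. dist y l \<le> dist y m)"
proof -
  obtain l where l: "l \<in> lattice a b" "x - l \<in> strict_voronoi0 a b"
    "\<forall>y\<in>interior (rect_set q). y - l \<in> strict_voronoi0 a b"
    using assms unfolding decided_def by blast
  have "dist y l \<le> dist y m" if "y \<in> interior (rect_set q)" "m \<in> lattice a b" for y m
    using strict_voronoi0_nearest[of y l a b m] l that by (cases "m = l") (auto simp: less_imp_le)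
  then show ?thesis using strict_voronoi0_nearest l by blast
qed

lemma error_free_subset:
  assumes "interior (rect_set q) \<subseteq> voronoi0 a b"
  shows "error_free a b q"
  using interior_maximal[OF assms open_interior] by (auto simp: error_free_def frontier_def)

lemma error_free_halve: "error_free a b r \<Longrightarrow> error_free a b (halve x r)"
  using interior_mono[OF rect_set_halve_subset[of x r]] by (auto simp: error_free_def)

lemma closure_interior_rect_set:
  assumes "proper q"
  shows "closure (interior (rect_set q)) = rect_set q"
  unfolding interior_rect_set using assms by (simp add: closure_Times proper_def rect_set_def)

lemma convex_interior_rect_set: "convex (interior (rect_set q))"
  by (simp add: interior_rect_set convex_Times)

text \<open>The interface between lattice geometry and halving: near side in the cell of 0, far side
  in the cell of \<open>n\<close>. The weak inequality in \<open>near\<close> puts the bisector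
  itself into \<open>voronoi0\<close>, as needed to find it on the frontier.\<close>

locale split_cell =
  fixes a b :: real and n :: pt and r :: rect
  assumes proper: "proper r" and diagonal: "diagonal n r" and n_lattice: "n \<in> lattice a b"
    and near: "\<And>p. p \<in> interior (rect_set r) \<Longrightarrow> p \<bullet> n \<le> (n \<bullet> n) / 2 \<Longrightarrow> p \<in> voronoi0 a b"
    and near_strict: "\<And>p. p \<in> interior (rect_set r) \<Longrightarrow> p \<bullet> n < (n \<bullet> n) / 2 \<Longrightarrow> p \<in> strict_voronoi0 a b"
    and far_strict: "\<And>p. p \<in> interior (rect_set r) \<Longrightarrow> p \<bullet> n > (n \<bullet> n) / 2 \<Longrightarrow> p - n \<in> strict_voronoi0 a b"
begin

lemma n_nonzero: "n \<noteq> 0"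
  using diagonal by (auto simp: diagonal_def)

text \<open>The near side is an open subset of the Voronoi cell, hence interior to it. The whole
  cell lies in the half-plane of \<open>n\<close>, so points on the bisector are not interior and
  points beyond it are outside.\<close>

lemma frontier_voronoi0_iff:
  assumes p: "p \<in> interior (rect_set r)"
  shows "p \<in> frontier (voronoi0 a b) \<longleftrightarrow> p \<in> bisector n"
proof -
  have half: "voronoi0 a b \<subseteq> {p. n \<bullet> p \<le> (n \<bullet> n) / 2}"
    using n_lattice by (auto simp: voronoi0_iff inner_commute)
  have front: "frontier (voronoi0 a b) = voronoi0 a b - interior (voronoi0 a b)"
    using closed_voronoi0 by (simp add: frontier_def)
  consider "p \<bullet> n < (n \<bullet> n) / 2" | "p \<bullet> n = (n \<bullet> n) / 2" | "p \<bullet> n > (n \<bullet> n) / 2"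
    by linarith
  then show ?thesis
  proof cases
    case 1
    have "open (interior (rect_set r) \<inter> {x. n \<bullet> x < (n \<bullet> n) / 2})"
      by (intro open_Int open_interior open_halfspace_lt)
    moreover have "interior (rect_set r) \<inter> {x. n \<bullet> x < (n \<bullet> n) / 2} \<subseteq> voronoi0 a b"
      using near by (auto simp: inner_commute)
    ultimately have "interior (rect_set r) \<inter> {x. n \<bullet> x < (n \<bullet> n) / 2} \<subseteq> interior (voronoi0 a b)"
      by (rule interior_maximal[rotated])
    then have "p \<in> interior (voronoi0 a b)" using 1 p by (auto simp: inner_commute)
    then show ?thesis using 1 front by (auto simp: bisector_def)
  next
    case 2
    have "interior (voronoi0 a b) \<subseteq> {p. n \<bullet> p < (n \<bullet> n) / 2}"
      using interior_mono[OF half] unfolding interior_halfspace_le[OF n_nonzero] .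
    moreover have "\<not> n \<bullet> p < (n \<bullet> n) / 2" using 2 inner_commute[of p n] by simp
    ultimately have "p \<notin> interior (voronoi0 a b)" by blast
    then show ?thesis using 2 near[OF p] front by (auto simp: bisector_def)
  next
    case 3
    then have "p \<notin> voronoi0 a b" using half by (auto simp: inner_commute)
    then show ?thesis using 3 front by (auto simp: bisector_def)
  qed
qed

lemma error_free_iff:
  assumes "interior (rect_set q) \<subseteq> interior (rect_set r)"
  shows "error_free a b q \<longleftrightarrow> \<not> meets (bisector n) q"
  using frontier_voronoi0_iff assms unfolding error_free_def meets_def by blast

text \<open>An open rectangle is connected, so if it misses the bisector it lies on one side. The
  point \<open>x\<close> is in its closure, hence weakly on that side, and strictly because it is
  off the bisector.\<close>

lemma error_free_decided:
  assumes sub: "interior (rect_set q) \<subseteq> interior (rect_set r)" and q: "proper q" "error_free a b q"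
    and x: "x \<in> interior (rect_set r)" "x \<in> rect_set q" "x \<notin> bisector n"
  shows "decided a b x q"
proof -
  let ?O = "interior (rect_set q)"
  have off: "y \<bullet> n \<noteq> (n \<bullet> n) / 2" if "y \<in> ?O" for y
    using that q(2) error_free_iff[OF sub] unfolding meets_def bisector_def by blast
  have xO: "x \<in> closure ?O" using x q closure_interior_rect_set by simp
  have "connected ?O" using convex_interior_rect_set by (rule convex_connected)
  then consider (near) "\<And>y. y \<in> ?O \<Longrightarrow> n \<bullet> y \<le> (n \<bullet> n) / 2"
    | (far) "\<And>y. y \<in> ?O \<Longrightarrow> n \<bullet> y \<ge> (n \<bullet> n) / 2"
    using connected_ivt_hyperplane[of ?O _ _ n "(n \<bullet> n) / 2"] off
    by (metis inner_commute linorder_le_cases)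
  then show ?thesis
  proof cases
    case near
    have "x \<in> {y. n \<bullet> y \<le> (n \<bullet> n) / 2}"
      using xO closure_minimal[of ?O "{y. n \<bullet> y \<le> (n \<bullet> n) / 2}"] near closed_halfspace_le by blast
    then have "x \<bullet> n < (n \<bullet> n) / 2" using x(3) by (simp add: bisector_def inner_commute)
    moreover have "y \<bullet> n < (n \<bullet> n) / 2" if "y \<in> ?O" for y
      using near[OF that] off[OF that] by (simp add: inner_commute)
    ultimately show ?thesis
      unfolding decided_def using near_strict x(1) sub zero_in_lattice
      by (intro bexI[of _ 0]) auto
  next
    case far
    have "x \<in> {y. n \<bullet> y \<ge> (n \<bullet> n) / 2}"
      using xO closure_minimal[of ?O "{y. n \<bullet> y \<ge> (n \<bullet> n) / 2}"] far closed_halfspace_ge by blast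
    then have "x \<bullet> n > (n \<bullet> n) / 2" using x(3) by (simp add: bisector_def inner_commute)
    moreover have "y \<bullet> n > (n \<bullet> n) / 2" if "y \<in> ?O" for y
      using far[OF that] off[OF that] by (simp add: inner_commute)
    ultimately show ?thesis
      unfolding decided_def using far_strict x(1) sub n_lattice
      by (intro bexI[of _ n]) auto
  qed
qed

lemma error_free_funpow_halve_iff:
  "error_free a b ((halve x ^^ k) r) \<longleftrightarrow> \<not> meets (bisector n) ((halve x ^^ k) r)"
  by (intro error_free_iff interior_mono rect_set_funpow_halve_subset)

lemma emeasure_not_error_free:
  "emeasure lborel {x \<in> half_open r. \<not> error_free a b ((halve x ^^ k) r)} = ennreal (area r / 2 ^ k)"
  using emeasure_undecided[OF proper diagonal] by (simp add: error_free_funpow_halve_iff)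

end

lemma mem_interior_flip:
  "p \<in> interior (rect_set (flip r)) \<longleftrightarrow> - p \<in> interior (rect_set r)"
  by (auto simp: interior_rect_set flip_def mem_Times_iff)

lemma split_cell_flip:
  assumes "split_cell a b n r"
  shows "split_cell a b (- n) (flip r)"
proof -
  interpret split_cell a b n r by fact
  note int = mem_interior_flip
  show ?thesis
  proof
    show "proper (flip r)" using proper by (simp add: proper_def flip_def)
    have c: "(- y + - x) / 2 = - ((x + y) / 2)" for x y :: real by argo
    show "diagonal (- n) (flip r)" using diagonal
      unfolding diagonal_def flip_def fst_conv snd_conv c
      by (simp add: bisector_def inner_prod_def)
    show "- n \<in> lattice a b" using n_lattice by (rule lattice_minus)
    fix p assume p: "p \<in> interior (rect_set (flip r))"
    show "p \<in> voronoi0 a b" if "p \<bullet> - n \<le> (- n \<bullet> - n) / 2"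
      using voronoi0_minus[OF near[of "- p"]] that p by (simp add: int)
    show "p \<in> strict_voronoi0 a b" if "p \<bullet> - n < (- n \<bullet> - n) / 2"
      using strict_voronoi0_minus[OF near_strict[of "- p"]] that p by (simp add: int)
    show "p - - n \<in> strict_voronoi0 a b" if "p \<bullet> - n > (- n \<bullet> - n) / 2"
      using strict_voronoi0_minus[OF far_strict[of "- p"]] that p by (simp add: int add.commute)
  qed
qed

section \<open>The cells of the protocol as instances\<close>

context obtuse
begin

text \<open>This is what node 1 gains by reporting the index of -X1 in the lower strip: everything
  there follows from the upper strip by point reflection.\<close>

lemma cell_flip: "cell a b (- 1) i = flip (cell a b 1 i)"
  by (simp add: cell_def flip_def Jint_def)

lemma split_cell_upper:
  assumes "i = 1 \<or> i = - 1"
  shows "split_cell a b (normal a b 1 i) (cell a b 1 i)"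
proof -
  have "(a, b) = (of_int 0 + of_int 1 * a, of_int 1 * b)"
    "(a - 1, b) = (of_int (- 1) + of_int 1 * a, of_int 1 * b)" by simp_all
  then have lat: "(a, b) \<in> lattice a b" "(a - 1, b) \<in> lattice a b"
    unfolding lattice_def mem_Collect_eq by (metis)+
  \<comment> \<open>The two numerical conditions of \<open>diagonal\<close> for either cell: the
    centre lies on the bisector, and the sides have the right ratio.\<close>
  have right: "(a / 2 + 1 / 2) / 2 * a + (tau1 a b + b / 2) / 2 * b = (a * a + b * b) / 2"
      "a * (1 / 2 - a / 2) = b * (b / 2 - tau1 a b)"
    and left: "(- 1 / 2 + (a - 1) / 2) / 2 * (a - 1) + (tau1 a b + b / 2) / 2 * b
        = ((a - 1) * (a - 1) + b * b) / 2"
      "(1 - a) * ((a - 1) / 2 - (- 1 / 2)) = b * (b / 2 - tau1 a b)"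
    using b_tau1 by (simp_all add: field_simps)
  have nz: "a \<noteq> 0" "b \<noteq> 0" "a - 1 \<noteq> 0"
    and abs: "\<bar>a\<bar> = a" "\<bar>b\<bar> = b" "\<bar>a - 1\<bar> = 1 - a"
    using a_pos b_pos a_less by auto
  show ?thesis
  proof (cases "i = 1")
    case True
    then have c: "cell a b 1 i = ((a / 2, 1 / 2), (tau1 a b, b / 2))" "normal a b 1 i = (a, b)"
      by (simp_all add: cell_def Iint_def Jint_def normal_def)
    show ?thesis unfolding c
    proof
      show "proper ((a / 2, 1 / 2), (tau1 a b, b / 2))" using a_less tau1_bounds by (simp add: proper_def)
      show "diagonal (a, b) ((a / 2, 1 / 2), (tau1 a b, b / 2))"
        unfolding diagonal_def bisector_def fst_conv snd_conv mem_Collect_eq inner_Pair inner_real_def abs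
        by (intro conjI nz right)
      show "(a, b) \<in> lattice a b" by (fact lat)
    qed (use upper_right_cell in \<open>auto simp: interior_rect_set\<close>)
  next
    case False
    then have c: "cell a b 1 i = ((- 1 / 2, (a - 1) / 2), (tau1 a b, b / 2))" "normal a b 1 i = (a - 1, b)"
      using assms by (simp_all add: cell_def Iint_def Jint_def normal_def)
    show ?thesis unfolding c
    proof
      show "proper ((- 1 / 2, (a - 1) / 2), (tau1 a b, b / 2))" using a_pos tau1_bounds by (simp add: proper_def)
      show "diagonal (a - 1, b) ((- 1 / 2, (a - 1) / 2), (tau1 a b, b / 2))"
        unfolding diagonal_def bisector_def fst_conv snd_conv mem_Collect_eq inner_Pair inner_real_def abs
        by (intro conjI nz left)
      show "(a - 1, b) \<in> lattice a b" by (fact lat)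
    qed (use upper_left_cell in \<open>auto simp: interior_rect_set\<close>)
  qed
qed

lemma split_cell_cell:
  assumes "i = 1 \<or> i = - 1" "j = 1 \<or> j = - 1"
  shows "split_cell a b (normal a b j i) (cell a b j i)"
proof (cases "j = 1")
  case True
  then show ?thesis using split_cell_upper assms by simp
next
  case False
  then have "normal a b j i = - normal a b 1 i" "cell a b j i = flip (cell a b 1 i)"
    using assms cell_flip by (auto simp: normal_def)
  then show ?thesis using split_cell_flip split_cell_upper assms(1) by metis
qed

lemma middle_cell_strict:
  assumes "j = 1 \<or> j = - 1"
  shows "interior (rect_set (cell a b j 0)) \<subseteq> strict_voronoi0 a b"
proof -
  have upper: "p \<in> strict_voronoi0 a b" if "p \<in> interior (rect_set (cell a b 1 0))" for p
    using that upper_middle_strict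
    by (cases p) (auto simp: interior_rect_set cell_def Iint_def Jint_def)
  have "p \<in> strict_voronoi0 a b" if "p \<in> interior (rect_set (cell a b (- 1) 0))" for p
    using upper[of "- p"] strict_voronoi0_minus[of "- p"] that
    unfolding cell_flip mem_interior_flip by simp
  then show ?thesis using assms upper by auto
qed

lemma central_rect_strict:
  "interior (rect_set ((- 1 / 2, 1 / 2), Jint a b 0)) \<subseteq> strict_voronoi0 a b"
  using central_strict by (auto simp: interior_rect_set Jint_def abs_less_iff)

end

section \<open>Exceptional lines, and measurability of the running time\<close>

lemma rect1_eq:
  "rect1 a b x = (if W2 a b x = 0 then ((- 1 / 2, 1 / 2), Jint a b 0)
     else cell a b (W2 a b x) (W1 a b x))"
  by (auto simp: rect1_def cell_def W2_def)

text \<open>Removes the lines where the endpoint conventions of messages, Babai cell and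
  \<open>half_open\<close> disagree, and the oblique bisectors, where the nearest point can be
  ambiguous. Midpoints of later rounds stay in, since \<open>half_open\<close> follows
  \<open>halve_iv\<close>.\<close>

definition generic :: "real \<Rightarrow> real \<Rightarrow> pt \<Rightarrow> bool" where
  "generic a b x \<longleftrightarrow>
     fst x \<notin> {1 / 2, - 1 / 2, (a - 1) / 2, (1 - a) / 2, a / 2, - a / 2} \<and>
     snd x \<notin> {tau1 a b, - tau1 a b, b / 2, - b / 2} \<and>
     (\<forall>n\<in>{(a, b), (a - 1, b), (- a, - b), (1 - a, - b)}. x \<notin> bisector n)"

text \<open>The index counts later rounds, so k = 0 is the state after round 1.\<close>

definition undecided :: "real \<Rightarrow> real \<Rightarrow> nat \<Rightarrow> pt set" where
  "undecided a b k = {x. \<not> error_free a b (rects a b x k)}"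

lemma AE_lborel_hyperplane:
  fixes e :: "'a::euclidean_space"
  assumes "e \<noteq> 0"
  shows "AE x in lborel. x \<bullet> e \<noteq> c"
proof -
  have "closed {x. e \<bullet> x = c}" by (rule closed_hyperplane)
  moreover have "{x. e \<bullet> x = c} \<in> null_sets lebesgue"
    using negligible_hyperplane[of e c] assms by (simp add: negligible_iff_null_sets)
  ultimately have "{x. e \<bullet> x = c} \<in> null_sets lborel"
    by (simp add: null_sets_completion_iff)
  then show ?thesis
    by (rule AE_I'[of "{x. e \<bullet> x = c}"]) (auto simp: inner_commute)
qed

lemma AE_lborel_pair_not_in:
  fixes A :: "real set"
  assumes "finite A"
  shows "AE x in (lborel :: pt measure). fst x \<notin> A" "AE x in (lborel :: pt measure). snd x \<notin> A"
proof -
  have "AE x in (lborel :: pt measure). \<forall>c\<in>A. x \<bullet> (1, 0) \<noteq> c"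
    using assms by (intro AE_ball_countable' AE_lborel_hyperplane countable_finite) (auto simp: zero_prod_def)
  then show "AE x in (lborel :: pt measure). fst x \<notin> A" by eventually_elim (auto simp: inner_prod_def)
  have "AE x in (lborel :: pt measure). \<forall>c\<in>A. x \<bullet> (0, 1) \<noteq> c"
    using assms by (intro AE_ball_countable' AE_lborel_hyperplane countable_finite) (auto simp: zero_prod_def)
  then show "AE x in (lborel :: pt measure). snd x \<notin> A" by eventually_elim (auto simp: inner_prod_def)
qed

lemma borel_measurable_fst_pt [measurable]: "fst \<in> borel_measurable (borel :: pt measure)"
  by (intro borel_measurable_continuous_onI continuous_intros)

lemma borel_measurable_snd_pt [measurable]: "snd \<in> borel_measurable (borel :: pt measure)"
  by (intro borel_measurable_continuous_onI continuous_intros)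

lemma measurable_W2 [measurable]: "W2 a b \<in> measurable borel (count_space UNIV)"
  unfolding W2_def[abs_def] by measurable

lemma measurable_W1 [measurable]: "W1 a b \<in> measurable borel (count_space UNIV)"
  unfolding W1_def[abs_def] Iidx_def by measurable

lemma W2_mem: "W2 a b x \<in> {- 1, 0, 1}"
  by (simp add: W2_def)

lemma W1_mem: "W1 a b x \<in> {- 1, 0, 1}"
  by (simp add: W1_def Iidx_def)

text \<open>Fixing the pair of messages fixes the starting rectangle, which reduces the claim to
  \<open>measurable_funpow_halve\<close>.\<close>

lemma measurable_undecided [measurable]: "undecided a b k \<in> sets borel"
proof -
  define \<Phi> where "\<Phi> = (\<lambda>r. \<not> error_free a b r)"
  define R where "R = (\<lambda>j i. if j = 0 then ((- 1 / 2, 1 / 2), Jint a b 0) else cell a b j i)"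
  have "undecided a b k = (\<Union>j\<in>{- 1, 0, 1}. \<Union>i\<in>{- 1, 0, 1}.
      {x. W2 a b x = j} \<inter> {x. W1 a b x = i} \<inter> {x. \<Phi> ((halve x ^^ k) (R j i))})" (is "_ = ?U")
  proof (rule set_eqI)
    fix x
    have "rect1 a b x = R (W2 a b x) (W1 a b x)" by (simp add: rect1_eq R_def)
    then have "x \<in> undecided a b k \<longleftrightarrow> \<Phi> ((halve x ^^ k) (R (W2 a b x) (W1 a b x)))"
      by (simp add: undecided_def rects_def \<Phi>_def)
    then show "x \<in> undecided a b k \<longleftrightarrow> x \<in> ?U"
      using W2_mem W1_mem unfolding UN_iff Int_iff mem_Collect_eq by metis
  qed
  moreover have "{x. W2 a b x = j} \<in> sets borel" "{x. W1 a b x = i} \<in> sets borel" for i j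
    by measurable
  ultimately show ?thesis
    using measurable_funpow_halve[of \<Phi>] by (auto intro!: sets.finite_UN)
qed

lemma undecided_antimono: "undecided a b (Suc k) \<subseteq> undecided a b k"
  unfolding undecided_def rects_def funpow.simps o_def using error_free_halve by blast

text \<open>Error-freeness survives halving, so the undecided sets decrease. \<open>halts\<close>
  guarantees that \<open>LEAST\<close> really is the first error-free index.\<close>

lemma less_Least_error_free_iff:
  assumes "halts a b x"
  shows "k < (LEAST k. error_free a b (rects a b x k)) \<longleftrightarrow> x \<in> undecided a b k"
proof
  assume "k < (LEAST k. error_free a b (rects a b x k))"
  then show "x \<in> undecided a b k" using not_less_Least by (auto simp: undecided_def)
next
  assume x: "x \<in> undecided a b k"
  have "error_free a b (rects a b x (LEAST k. error_free a b (rects a b x k)))"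
    using assms unfolding halts_def by (rule LeastI_ex)
  moreover have "undecided a b n \<subseteq> undecided a b m" if "m \<le> n" for m n
    using that by (rule lift_Suc_antimono_le[of "undecided a b", OF undecided_antimono])
  ultimately show "k < (LEAST k. error_free a b (rects a b x k))"
    using x unfolding undecided_def by (metis (mono_tags, lifting) linorder_not_less mem_Collect_eq subsetD)
qed

section \<open>Distribution of the number of rounds, and correctness\<close>

context obtuse
begin

lemma babai_measurable [measurable]: "babai_cell b \<in> sets borel"
  by (simp add: babai_cell_def borel_Times)

lemma emeasure_babai: "emeasure lborel (babai_cell b) = ennreal b"
proof -
  have "emeasure lborel (babai_cell b) = ennreal ((1 / 2 - (- 1 / 2)) * (b / 2 - (- b / 2)))"
    using b_pos by (intro emeasure_lborel_rect) (auto simp: babai_cell_def borel_Times)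
  then show ?thesis by simp
qed

lemma sets_Mu [measurable_cong]: "sets (Mu b) = sets borel"
  by (simp add: Mu_def)

lemma space_Mu [simp]: "space (Mu b) = UNIV"
  by (simp add: Mu_def)

lemma prob_space_Mu: "prob_space (Mu b)"
  unfolding Mu_def using b_pos by (intro prob_space_uniform_measure) (auto simp: emeasure_babai)

lemma AE_generic: "AE x in lborel. generic a b x"
proof -
  have "AE x in lborel. \<forall>n\<in>{(a, b), (a - 1, b), (- a, - b), (1 - a, - b)}. x \<notin> bisector n"
    unfolding bisector_def mem_Collect_eq
    using b_pos by (intro AE_ball_countable' AE_lborel_hyperplane countable_finite) (auto simp: zero_prod_def)
  then show ?thesis
    using AE_lborel_pair_not_in(1)[of "{1 / 2, - 1 / 2, (a - 1) / 2, (1 - a) / 2, a / 2, - a / 2}"]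
      AE_lborel_pair_not_in(2)[of "{tau1 a b, - tau1 a b, b / 2, - b / 2}"]
    unfolding generic_def by simp
qed

lemma AE_Mu_generic: "AE x in Mu b. x \<in> babai_cell b \<and> generic a b x"
  unfolding Mu_def using AE_generic
  by (intro AE_uniform_measureI) (auto elim: eventually_mono)

lemma generic_cell_iff:
  assumes x: "generic a b x" and "j = 1 \<or> j = - 1" "i = - 1 \<or> i = 0 \<or> i = 1"
  shows "x \<in> half_open (cell a b j i) \<longleftrightarrow> x \<in> babai_cell b \<and> W2 a b x = j \<and> W1 a b x = i"
    and "x \<in> half_open (cell a b j i) \<Longrightarrow> x \<in> interior (rect_set (cell a b j i))"
proof -
  obtain x1 x2 where xx: "x = (x1, x2)" by (cases x)
  have g: "x1 \<noteq> 1 / 2" "x1 \<noteq> - 1 / 2" "x1 \<noteq> (a - 1) / 2" "x1 \<noteq> (1 - a) / 2" "x1 \<noteq> a / 2" "x1 \<noteq> - a / 2"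
    "x2 \<noteq> tau1 a b" "x2 \<noteq> - tau1 a b" "x2 \<noteq> b / 2" "x2 \<noteq> - b / 2"
    using x by (auto simp: generic_def xx)
  show "x \<in> half_open (cell a b j i) \<longleftrightarrow> x \<in> babai_cell b \<and> W2 a b x = j \<and> W1 a b x = i"
    using assms(2,3) g a_pos a_less tau1_bounds
    by (elim disjE; simp add: xx half_open_def cell_def Iint_def Jint_def babai_cell_def W2_def W1_def Iidx_def;
      argo)
  show "x \<in> interior (rect_set (cell a b j i))" if "x \<in> half_open (cell a b j i)"
    using that assms(2,3) g
    by (elim disjE; simp add: xx half_open_def interior_rect_set cell_def Iint_def Jint_def; argo)
qed

lemma generic_central:
  assumes x: "generic a b x" and "x \<in> babai_cell b" "W2 a b x = 0"
  shows "x \<in> interior (rect_set ((- 1 / 2, 1 / 2), Jint a b 0))"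
  using assms by (cases x)
    (auto simp: generic_def babai_cell_def W2_def interior_rect_set Jint_def split: if_splits)

text \<open>If W2 = 0 or W1 = 0, the round-one rectangle has its interior inside the strict cell and
  is error-free at once; only the four outer cells remain.\<close>

lemma undecided_iff:
  assumes x: "generic a b x"
  shows "x \<in> babai_cell b \<inter> undecided a b k \<longleftrightarrow>
    (\<exists>(j, i)\<in>{1, - 1} \<times> {1, - 1}. x \<in> half_open (cell a b j i) \<and>
       \<not> error_free a b ((halve x ^^ k) (cell a b j i)))" (is "?L \<longleftrightarrow> ?R")
proof
  assume ?L
  have sub: "interior (rect_set (rects a b x k)) \<subseteq> interior (rect_set (rect1 a b x))"
    unfolding rects_def by (intro interior_mono rect_set_funpow_halve_subset)
  have nsub: "\<not> interior (rect_set (rect1 a b x)) \<subseteq> strict_voronoi0 a b"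
    using \<open>?L\<close> error_free_subset[of "rects a b x k" a b] sub strict_voronoi0_subset[of a b]
    unfolding undecided_def by blast
  then have W2: "W2 a b x \<noteq> 0" using central_rect_strict by (auto simp: rect1_eq)
  then have W2': "W2 a b x = 1 \<or> W2 a b x = - 1" using W2_mem[of a b x] by auto
  then have "W1 a b x \<noteq> 0" using nsub W2 middle_cell_strict[OF W2'] by (auto simp only: rect1_eq if_False)
  then have W1: "W1 a b x = 1 \<or> W1 a b x = - 1" using W1_mem[of a b x] by auto
  have "x \<in> half_open (cell a b (W2 a b x) (W1 a b x))"
    using generic_cell_iff(1)[OF x W2'] W1 \<open>?L\<close> by blast
  moreover have "\<not> error_free a b ((halve x ^^ k) (cell a b (W2 a b x) (W1 a b x)))"
    using \<open>?L\<close> W2 by (simp add: undecided_def rects_def rect1_eq)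
  ultimately show ?R using W1 W2' by (intro bexI[of _ "(W2 a b x, W1 a b x)"]) auto
next
  assume ?R
  then obtain j i where ji: "j = 1 \<or> j = - 1" "i = 1 \<or> i = - 1"
    and in_cell: "x \<in> half_open (cell a b j i)"
    and ef: "\<not> error_free a b ((halve x ^^ k) (cell a b j i))"
    by blast
  then have "x \<in> babai_cell b \<and> W2 a b x = j \<and> W1 a b x = i"
    using generic_cell_iff(1)[OF x ji(1)] by blast
  then show ?L using ef ji(1) by (auto simp: undecided_def rects_def rect1_eq)
qed

lemma proper_cell:
  assumes "j = 1 \<or> j = - 1" "i = - 1 \<or> i = 0 \<or> i = 1"
  shows "proper (cell a b j i)"
  using assms a_pos a_less tau1_bounds by (elim disjE) (simp_all add: proper_def cell_def Iint_def Jint_def)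

lemma area_cell:
  assumes "j = 1 \<or> j = - 1"
  shows "area (cell a b j (- 1)) = a / 2 * (b / 2 - tau1 a b)"
    "area (cell a b j 0) = 1 / 2 * (b / 2 - tau1 a b)"
    "area (cell a b j 1) = (1 - a) / 2 * (b / 2 - tau1 a b)"
proof -
  have "(a - 1) / 2 - - 1 / 2 = a / 2" "a / 2 - (a - 1) / 2 = 1 / 2" "1 / 2 - a / 2 = (1 - a) / 2"
    by argo+
  then show "area (cell a b j (- 1)) = a / 2 * (b / 2 - tau1 a b)"
    "area (cell a b j 0) = 1 / 2 * (b / 2 - tau1 a b)"
    "area (cell a b j 1) = (1 - a) / 2 * (b / 2 - tau1 a b)"
    using assms by (auto simp: area_def cell_def Iint_def Jint_def)
qed

lemma half_open_cells_disjoint: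
  "disjoint_family_on (\<lambda>(j, i). half_open (cell a b j i)) ({1, - 1} \<times> {1, - 1})"
proof -
  \<comment> \<open>Separates the reflected X1-intervals of the two lower outer cells.\<close>
  have "False" if "- ((a - 1) / 2) < t" "t \<le> - (a / 2)" for t
    using that by argo
  then show ?thesis
    using a_pos a_less tau1_bounds
    by (auto simp: disjoint_family_on_def half_open_def cell_def Iint_def Jint_def)
qed

text \<open>The outer widths a/2 and (1 - a)/2 add up to 1/2. Two strips of height
  \<open>b / 2 - tau1 a b\<close> thus give the initial area, which each later round halves.\<close>

lemma emeasure_babai_undecided:
  "emeasure lborel (babai_cell b \<inter> undecided a b k) = ennreal ((b / 2 - tau1 a b) / 2 ^ k)"
proof -
  define I :: "(int \<times> int) set" where "I = {1, - 1} \<times> {1, - 1}"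
  define E where "E = (\<lambda>(j, i). {x \<in> half_open (cell a b j i). \<not> error_free a b ((halve x ^^ k) (cell a b j i))})"
  have E_sets: "E ji \<in> sets borel" for ji
  proof -
    obtain j i where ji: "ji = (j, i)" by (cases ji)
    have "E ji = half_open (cell a b j i) \<inter> {x. \<not> error_free a b ((halve x ^^ k) (cell a b j i))}"
      by (auto simp: E_def ji)
    then show ?thesis using measurable_funpow_halve[of "\<lambda>r. \<not> error_free a b r"] by auto
  qed
  have I: "finite I" by (simp add: I_def)
  have "disjoint_family_on E I"
    using half_open_cells_disjoint unfolding disjoint_family_on_def I_def E_def by fastforce
  then have "emeasure lborel (\<Union>ji\<in>I. E ji) = (\<Sum>ji\<in>I. emeasure lborel (E ji))"
    using E_sets I by (intro sum_emeasure[symmetric]) auto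
  also have "\<dots> = (\<Sum>(j, i)\<in>I. ennreal (area (cell a b j i) / 2 ^ k))"
  proof (intro sum.cong refl)
    fix ji assume "ji \<in> I"
    then obtain j i where ji: "ji = (j, i)" "j = 1 \<or> j = - 1" "i = 1 \<or> i = - 1" by (auto simp: I_def)
    interpret split_cell a b "normal a b j i" "cell a b j i" using ji by (intro split_cell_cell)
    show "emeasure lborel (E ji) = (case ji of (j, i) \<Rightarrow> ennreal (area (cell a b j i) / 2 ^ k))"
      using emeasure_not_error_free by (simp add: E_def ji)
  qed
  also have "\<dots> = ennreal (\<Sum>(j, i)\<in>I. area (cell a b j i) / 2 ^ k)"
    using a_pos a_less tau1_bounds
    by (subst sum_ennreal[symmetric]) (auto simp: I_def area_cell case_prod_beta intro!: sum.cong)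
  also have "(\<Sum>(j, i)\<in>I. area (cell a b j i) / 2 ^ k) = (b / 2 - tau1 a b) / 2 ^ k"
  proof -
    have "(\<Sum>(j, i)\<in>I. area (cell a b j i) / 2 ^ k)
      = 2 * ((1 - a) / 2 * (b / 2 - tau1 a b) + a / 2 * (b / 2 - tau1 a b)) / 2 ^ k"
      unfolding I_def sum.cartesian_product[symmetric] by (simp add: area_cell add_divide_distrib)
    also have "2 * ((1 - a) / 2 * (b / 2 - tau1 a b) + a / 2 * (b / 2 - tau1 a b)) = b / 2 - tau1 a b"
      by (simp add: field_simps)
    finally show ?thesis .
  qed
  finally have "emeasure lborel (\<Union>ji\<in>I. E ji) = ennreal ((b / 2 - tau1 a b) / 2 ^ k)" .
  moreover have "emeasure lborel (babai_cell b \<inter> undecided a b k) = emeasure lborel (\<Union>ji\<in>I. E ji)"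
  proof (rule emeasure_eq_AE)
    show "AE x in lborel. x \<in> babai_cell b \<inter> undecided a b k \<longleftrightarrow> x \<in> (\<Union>ji\<in>I. E ji)"
      using AE_generic
    proof eventually_elim
      case (elim x)
      show ?case unfolding undecided_iff[OF elim] I_def E_def by auto
    qed
  qed (use E_sets I in auto)
  ultimately show ?thesis by simp
qed

text \<open>This is a(1 - a)/(2b^2), the common value of Q_1 and Q_{-1}. Since the outer intervals
  take up half the width, it is also the probability that W2 and W1 are both nonzero.\<close>

definition outer_prob :: real where "outer_prob = (b / 2 - tau1 a b) / b"

lemma outer_prob_pos: "0 < outer_prob"
  using tau1_bounds b_pos by (simp add: outer_prob_def)

lemma emeasure_Mu_undecided: "emeasure (Mu b) (undecided a b k) = ennreal (outer_prob / 2 ^ k)"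
proof -
  have "emeasure (Mu b) (undecided a b k)
      = emeasure lborel (babai_cell b \<inter> undecided a b k) / emeasure lborel (babai_cell b)"
    unfolding Mu_def by (intro emeasure_uniform_measure) auto
  also have "\<dots> = ennreal ((b / 2 - tau1 a b) / 2 ^ k / b)"
    unfolding emeasure_babai_undecided emeasure_babai
    using tau1_bounds b_pos by (intro divide_ennreal) auto
  finally show ?thesis by (simp add: outer_prob_def mult.commute)
qed

lemma geometric_outer_prob: "(\<lambda>k. outer_prob / 2 ^ k) sums (2 * outer_prob)"
  using sums_mult[OF geometric_sums[of "1 / 2 :: real"], of outer_prob] by (simp add: power_divide mult.commute)

lemma AE_halts: "AE x in Mu b. halts a b x"
proof -
  have "(\<lambda>k. emeasure (Mu b) (undecided a b k)) \<longlonglongrightarrow> ennreal 0"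
    unfolding emeasure_Mu_undecided
    by (intro tendsto_ennrealI summable_LIMSEQ_zero sums_summable[OF geometric_outer_prob])
  then have "emeasure (Mu b) (\<Inter>k. undecided a b k) \<le> ennreal 0"
    by (rule LIMSEQ_le_const) (auto intro!: emeasure_mono)
  then have "(\<Inter>k. undecided a b k) \<in> null_sets (Mu b)"
    by (auto intro!: null_setsI)
  then show ?thesis
    by (rule AE_I') (auto simp: undecided_def halts_def)
qed

text \<open>Genericity puts \<open>x\<close> in the interior of its round-one rectangle, even though
  it may reach an edge later. If either message is 0 the decision is 0; otherwise
  \<open>error_free_decided\<close> applies to an outer cell.\<close>

lemma final_decided:
  assumes x: "x \<in> babai_cell b" "generic a b x" and "halts a b x"
  shows "x \<in> rect_set (final_rect a b x)" "decided a b x (final_rect a b x)"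
proof -
  define k where "k = (LEAST k. error_free a b (rects a b x k))"
  have final: "final_rect a b x = rects a b x k"
    by (simp add: final_rect_def num_rounds_def k_def)
  have ef: "error_free a b (final_rect a b x)"
    unfolding final k_def using assms(3) unfolding halts_def by (rule LeastI_ex)
  have sub: "interior (rect_set (final_rect a b x)) \<subseteq> interior (rect_set (rect1 a b x))"
    unfolding final rects_def by (intro interior_mono rect_set_funpow_halve_subset)
  have W2: "W2 a b x = 1 \<or> W2 a b x = - 1" if "W2 a b x \<noteq> 0" using that W2_mem[of a b x] by auto
  have W1: "W1 a b x = - 1 \<or> W1 a b x = 0 \<or> W1 a b x = 1" using W1_mem[of a b x] by auto
  have x1: "x \<in> interior (rect_set (rect1 a b x))"
  proof (cases "W2 a b x = 0")
    case True
    then show ?thesis using generic_central[OF x(2,1)] by (simp add: rect1_eq)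
  next
    case False
    then show ?thesis using generic_cell_iff[OF x(2) W2[OF False] W1] x(1) by (simp add: rect1_eq)
  qed
  then show xr: "x \<in> rect_set (final_rect a b x)"
    unfolding final rects_def using interior_subset by (intro mem_rect_set_funpow_halve) blast
  show "decided a b x (final_rect a b x)"
  proof (cases "W2 a b x = 0 \<or> W1 a b x = 0")
    case True
    then have "interior (rect_set (rect1 a b x)) \<subseteq> strict_voronoi0 a b"
      using central_rect_strict middle_cell_strict[OF W2] by (cases "W2 a b x = 0") (simp_all add: rect1_eq)
    then show ?thesis using x1 sub zero_in_lattice unfolding decided_def
      by (intro bexI[of _ 0]) auto
  next
    case False
    then have ji: "W1 a b x = 1 \<or> W1 a b x = - 1" "W2 a b x = 1 \<or> W2 a b x = - 1" and "W2 a b x \<noteq> 0"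
      using W1 W2 by auto
    then have r1: "rect1 a b x = cell a b (W2 a b x) (W1 a b x)" by (simp add: rect1_eq)
    interpret split_cell a b "normal a b (W2 a b x) (W1 a b x)" "rect1 a b x"
      unfolding r1 using ji by (rule split_cell_cell)
    have "x \<notin> bisector (normal a b (W2 a b x) (W1 a b x))"
      using x(2) ji by (auto simp: generic_def normal_def)
    then show ?thesis
      using sub ef x1 xr proper by (intro error_free_decided) (auto simp: final rects_def proper_funpow_halve)
  qed
qed

section \<open>Message probabilities and expectations\<close>

lemma measure_Mu_rect:
  assumes "S \<in> sets borel" "proper r"
    and S: "\<And>x. generic a b x \<Longrightarrow> x \<in> babai_cell b \<inter> S \<longleftrightarrow> x \<in> half_open r"
  shows "measure (Mu b) S = area r / b"
proof -
  have "emeasure lborel (babai_cell b \<inter> S) = emeasure lborel (half_open r)"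
  proof (rule emeasure_eq_AE)
    show "AE x in lborel. x \<in> babai_cell b \<inter> S \<longleftrightarrow> x \<in> half_open r"
      using AE_generic by eventually_elim (rule S)
  qed (use assms(1) in auto)
  moreover have "0 \<le> area r" using assms(2) by (simp add: area_def proper_def)
  moreover have "emeasure (Mu b) S = emeasure lborel (babai_cell b \<inter> S) / emeasure lborel (babai_cell b)"
    unfolding Mu_def using assms(1) by (intro emeasure_uniform_measure) auto
  ultimately have "emeasure (Mu b) S = ennreal (area r / b)"
    using b_pos by (simp add: emeasure_half_open[OF assms(2)] emeasure_babai divide_ennreal)
  then show ?thesis
    using \<open>0 \<le> area r\<close> b_pos by (simp add: measure_def)
qed

lemma measure_W2_W1:
  assumes "j = 1 \<or> j = - 1"
  shows "measure (Mu b) {x. W2 a b x = j \<and> W1 a b x = - 1} = a / 2 * outer_prob"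
    "measure (Mu b) {x. W2 a b x = j \<and> W1 a b x = 0} = 1 / 2 * outer_prob"
    "measure (Mu b) {x. W2 a b x = j \<and> W1 a b x = 1} = (1 - a) / 2 * outer_prob"
proof -
  have "measure (Mu b) {x. W2 a b x = j \<and> W1 a b x = i} = area (cell a b j i) / b"
    if "i = - 1 \<or> i = 0 \<or> i = 1" for i
    using proper_cell[OF assms that] generic_cell_iff(1)[OF _ assms that]
    by (intro measure_Mu_rect) (simp_all, measurable)
  then show "measure (Mu b) {x. W2 a b x = j \<and> W1 a b x = - 1} = a / 2 * outer_prob"
    "measure (Mu b) {x. W2 a b x = j \<and> W1 a b x = 0} = 1 / 2 * outer_prob"
    "measure (Mu b) {x. W2 a b x = j \<and> W1 a b x = 1} = (1 - a) / 2 * outer_prob"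
    by (simp_all add: area_cell[OF assms] outer_prob_def)
qed

lemma Qprob_outer:
  assumes "j = 1 \<or> j = - 1"
  shows "Qprob a b j = outer_prob"
proof -
  interpret prob_space "Mu b" by (rule prob_space_Mu)
  have meas: "{x. W2 a b x = j \<and> W1 a b x = i} \<in> sets (Mu b)" for i by measurable
  have "{x. W2 a b x = j} = (\<Union>i\<in>{- 1, 0, 1}. {x. W2 a b x = j \<and> W1 a b x = i})"
    using W1_mem[of a b] by blast
  also have "prob \<dots> = (\<Sum>i\<in>{- 1, 0, 1}. prob {x. W2 a b x = j \<and> W1 a b x = i})"
    using meas by (intro finite_measure_finite_Union) (auto simp: disjoint_family_on_def)
  also have "\<dots> = outer_prob"
    by (simp add: measure_W2_W1[OF assms]) (simp add: field_simps)
  finally show ?thesis by (simp add: Qprob_def)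
qed

lemma Qprob_0: "Qprob a b 0 = 1 - 2 * outer_prob"
proof -
  interpret prob_space "Mu b" by (rule prob_space_Mu)
  have meas: "{x. W2 a b x = j} \<in> sets (Mu b)" for j by measurable
  have "(\<Sum>j\<in>{- 1, 0, 1}. prob {x. W2 a b x = j}) = prob (\<Union>j\<in>{- 1, 0, 1}. {x. W2 a b x = j})"
    using meas by (intro finite_measure_finite_Union[symmetric]) (auto simp: disjoint_family_on_def)
  also have "(\<Union>j\<in>{- 1, 0, 1}. {x. W2 a b x = j}) = space (Mu b)"
    using W2_mem[of a b] by auto
  finally show ?thesis
    using Qprob_outer[of 1] Qprob_outer[of "- 1"] unfolding Qprob_def prob_space by simp
qed

lemma Pcond_values:
  assumes "j = 1 \<or> j = - 1"
  shows "Pcond a b j (- 1) = a / 2" "Pcond a b j 0 = 1 / 2" "Pcond a b j 1 = (1 - a) / 2"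
  using outer_prob_pos by (simp_all add: Pcond_def measure_W2_W1[OF assms] Qprob_outer[OF assms])

lemma Qprob_0_pos: "0 < Qprob a b 0"
proof -
  have "Qprob a b 0 = 2 * tau1 a b / b"
    using b_pos by (simp add: Qprob_0 outer_prob_def field_simps)
  then show ?thesis using tau1_bounds b_pos by simp
qed

lemma num_rounds_measurable [measurable]: "num_rounds a b \<in> measurable (Mu b) (count_space UNIV)"
proof -
  have "Measurable.pred (Mu b) (\<lambda>x. error_free a b (rects a b x k))" for k
  proof -
    have "{x. error_free a b (rects a b x k)} = - undecided a b k"
      by (auto simp: undecided_def)
    also have "\<dots> \<in> sets (Mu b)" unfolding sets_Mu by (intro borel_comp measurable_undecided)
    finally show ?thesis by (simp add: pred_def)
  qed
  then show ?thesis unfolding num_rounds_def[abs_def] by measurable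
qed

text \<open>The tail formula E[L] = sum over k of Pr(L > k), with L the number of later rounds.
  Finiteness of the nonnegative integral yields integrability together with the value.\<close>

lemma extra_rounds:
  "has_bochner_integral (Mu b) (\<lambda>x. real (num_rounds a b x - 1)) (2 * outer_prob)"
proof (rule has_bochner_integral_nn_integral)
  define L where "L = (\<lambda>x. num_rounds a b x - 1)"
  have [measurable]: "L \<in> measurable (Mu b) (count_space UNIV)" unfolding L_def by measurable
  have "(\<integral>\<^sup>+x. ennreal (real (L x)) \<partial>Mu b) = (\<Sum>k. emeasure (Mu b) {x \<in> space (Mu b). k < L x})"
    using nn_integral_nat_function[of L "Mu b"] by (simp add: ennreal_of_nat_eq_real_of_nat)
  also have "\<dots> = (\<Sum>k. ennreal (outer_prob / 2 ^ k))"
  proof (intro suminf_cong)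
    fix k
    have "emeasure (Mu b) {x \<in> space (Mu b). k < L x} = emeasure (Mu b) (undecided a b k)"
    proof (rule emeasure_eq_AE)
      \<comment> \<open>Only almost everywhere: off the halting set the value of
        \<open>LEAST\<close> is unspecified.\<close>
      show "AE x in Mu b. x \<in> {x \<in> space (Mu b). k < L x} \<longleftrightarrow> x \<in> undecided a b k"
        using AE_halts by eventually_elim (simp add: L_def num_rounds_def less_Least_error_free_iff)
    qed (simp_all add: sets_Mu)
    then show "emeasure (Mu b) {x \<in> space (Mu b). k < L x} = ennreal (outer_prob / 2 ^ k)"
      by (simp add: emeasure_Mu_undecided)
  qed
  also have "\<dots> = ennreal (2 * outer_prob)"
    using outer_prob_pos by (intro suminf_ennreal_eq geometric_outer_prob) simp
  finally show "(\<integral>\<^sup>+x. ennreal (real (num_rounds a b x - 1)) \<partial>Mu b) = ennreal (2 * outer_prob)"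
    by (simp add: L_def)
  show "(\<lambda>x. real (num_rounds a b x - 1)) \<in> borel_measurable (Mu b)" by measurable
qed (use outer_prob_pos in auto)

lemma has_bochner_integral_round1_cost:
  "has_bochner_integral (Mu b) (round1_cost a b)
     (entropy3 (Qprob a b) + (1 - Qprob a b 0) * entropy3 (Pcond a b 1))"
proof -
  interpret prob_space "Mu b" by (rule prob_space_Mu)
  define C D where "C = (\<lambda>j. log 2 (1 / Qprob a b j))" and "D = (\<lambda>i. log 2 (1 / Pcond a b 1 i))"
  define S T where "S = (\<lambda>j. {x. W2 a b x = j})" and "T = (\<lambda>j i. {x. W2 a b x = j \<and> W1 a b x = i})"
  have meas: "S j \<in> sets (Mu b)" "T j i \<in> sets (Mu b)" for i j
    unfolding S_def T_def by measurable
  have ind: "has_bochner_integral (Mu b) (indicator A :: pt \<Rightarrow> real) (prob A)" if "A \<in> sets (Mu b)" for A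
    using that by (intro has_bochner_integral_real_indicator) (auto simp: emeasure_eq_measure)
  have Pm: "Pcond a b (- 1) i = Pcond a b 1 i" if "i \<in> {- 1, 0, 1}" for i
    using that Pcond_values[of 1] Pcond_values[of "- 1"] by auto
  \<comment> \<open>The cost takes finitely many values, fixed by the messages. By \<open>Pm\<close>
    the code of node 1 is the same in both strips, so one coefficient \<open>D i\<close> serves
    both.\<close>
  have cost: "round1_cost a b x = (\<Sum>j\<in>{- 1, 0, 1}. C j * indicator (S j) x)
      + (\<Sum>i\<in>{- 1, 0, 1}. D i * (indicator (T 1 i) x + indicator (T (- 1) i) x))" for x
    using W2_mem[of a b x] W1_mem[of a b x] Pm
    by (auto simp: round1_cost_def C_def D_def S_def T_def indicator_def)
  have "has_bochner_integral (Mu b) (\<lambda>x. (\<Sum>j\<in>{- 1, 0, 1}. C j * indicator (S j) x)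
      + (\<Sum>i\<in>{- 1, 0, 1}. D i * (indicator (T 1 i) x + indicator (T (- 1) i) x)))
     ((\<Sum>j\<in>{- 1, 0, 1}. C j * prob (S j)) + (\<Sum>i\<in>{- 1, 0, 1}. D i * (prob (T 1 i) + prob (T (- 1) i))))"
    by (intro has_bochner_integral_add has_bochner_integral_sum has_bochner_integral_mult_right ind meas)
  moreover have "(\<Sum>j\<in>{- 1, 0, 1}. C j * prob (S j)) = entropy3 (Qprob a b)"
    unfolding entropy3_def
    using Qprob_0_pos outer_prob_pos
    by (intro sum.cong) (auto simp: C_def S_def Qprob_def[symmetric] log_divide Qprob_outer)
  moreover have "(\<Sum>i\<in>{- 1, 0, 1}. D i * (prob (T 1 i) + prob (T (- 1) i)))
      = (1 - Qprob a b 0) * entropy3 (Pcond a b 1)"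
    unfolding entropy3_def sum_distrib_left
  proof (intro sum.cong refl)
    fix i :: int assume i: "i \<in> {- 1, 0, 1}"
    \<comment> \<open>Adding both strips gives the weight 2 \<open>outer_prob\<close> P_i = (1 -
      Q_0) P_i. Positivity of P_i selects the logarithmic branch of \<open>entropy3\<close>.\<close>
    have "prob (T j i) = Pcond a b 1 i * outer_prob" if "j = 1 \<or> j = - 1" for j
      using i by (auto simp: T_def measure_W2_W1[OF that] Pcond_values)
    moreover have "0 < Pcond a b 1 i" using i Pcond_values[of 1] a_pos a_less by auto
    ultimately show "D i * (prob (T 1 i) + prob (T (- 1) i)) = (1 - Qprob a b 0) *
        (if Pcond a b 1 i = 0 then 0 else - Pcond a b 1 i * log 2 (Pcond a b 1 i))"
      by (simp add: D_def log_divide Qprob_0)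
  qed
  ultimately show ?thesis unfolding cost[abs_def] by simp
qed

end

theorem mainTheorem1:
  fixes \<rho> \<theta> a b :: real and Q P :: "int \<Rightarrow> real"
  assumes a_def: "a = \<rho> * cos \<theta>" and b_def: "b = \<rho> * sin \<theta>"
    and "1 \<le> \<rho>" and "0 < a" and "a < 1/2" and "0 < b"
    and Q_def: "Q = Qprob a b" and P_def: "P = Pcond a b 1"
  shows "(AE x in Mu b. halts a b x \<and> x \<in> rect_set (final_rect a b x) \<and>
            (\<exists>l\<in>lattice a b. (\<forall>m\<in>lattice a b. m \<noteq> l \<longrightarrow> dist x l < dist x m) \<and>
               (\<forall>y\<in>interior (rect_set (final_rect a b x)). \<forall>m\<in>lattice a b. dist y l \<le> dist y m)))
       \<and> integrable (Mu b) (num_bits a b)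
       \<and> integrable (Mu b) (\<lambda>x. real (num_rounds a b x))
       \<and> (\<integral>x. num_bits a b x \<partial>Mu b) = entropy3 Q + (1 - Q 0) * entropy3 P + 4 * (1 - P 0) * (1 - Q 0)
       \<and> (\<integral>x. real (num_rounds a b x) \<partial>Mu b) = 1 + 2 * (1 - P 0) * (1 - Q 0)"
proof -
  have "a\<^sup>2 + b\<^sup>2 = \<rho>\<^sup>2" by (simp add: a_def b_def power_mult_distrib flip: distrib_left)
  moreover have "1 \<le> \<rho>\<^sup>2" using \<open>1 \<le> \<rho>\<close> by simp
  \<comment> \<open>From b^2 \<ge> 1 - a^2 and a < 1 it follows that b^2 > a - a^2.\<close>
  ultimately have "a * (1 - a) < b * b"
    using \<open>a < 1/2\<close> by (simp add: power2_eq_square algebra_simps)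
  then interpret obtuse a b using assms by unfold_locales auto
  interpret prob_space "Mu b" by (rule prob_space_Mu)
  \<comment> \<open>So (1 - P_0)(1 - Q_0) equals \<open>outer_prob\<close>: the 2
    \<open>outer_prob\<close> expected later rounds, at two bits each, give the last terms of both
    formulas.\<close>
  have Q0: "1 - Q 0 = 2 * outer_prob" and P0: "1 - P 0 = 1 / 2"
    using Qprob_0 Pcond_values(2)[of 1] by (auto simp: Q_def P_def)
  have "AE x in Mu b. halts a b x \<and> x \<in> rect_set (final_rect a b x) \<and> decided a b x (final_rect a b x)"
    using AE_Mu_generic AE_halts by eventually_elim (auto intro: final_decided)
  then have "AE x in Mu b. halts a b x \<and> x \<in> rect_set (final_rect a b x) \<and>
            (\<exists>l\<in>lattice a b. (\<forall>m\<in>lattice a b. m \<noteq> l \<longrightarrow> dist x l < dist x m) \<and>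
               (\<forall>y\<in>interior (rect_set (final_rect a b x)). \<forall>m\<in>lattice a b. dist y l \<le> dist y m))"
    by eventually_elim (use decidedD in blast)
  moreover have "has_bochner_integral (Mu b) (num_bits a b)
      (entropy3 Q + (1 - Q 0) * entropy3 P + 2 * (2 * outer_prob))"
    unfolding num_bits_def[abs_def] Q_def P_def
    by (intro has_bochner_integral_add has_bochner_integral_round1_cost
        has_bochner_integral_mult_right extra_rounds)
  moreover have "has_bochner_integral (Mu b) (\<lambda>x. 1 + real (num_rounds a b x - 1)) (1 + 2 * outer_prob)"
    by (intro has_bochner_integral_add extra_rounds)
      (simp add: has_bochner_integral_iff prob_space[unfolded space_Mu])
  moreover have "1 + real (num_rounds a b x - 1) = real (num_rounds a b x)" for x
    by (simp add: num_rounds_def)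
  ultimately show ?thesis
    unfolding has_bochner_integral_iff Q0 P0 by simp
qed

end
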